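(* Let $X$ be a separable Banach space, $\mu_{\mathrm{prior}}\in\mathcal P_1(X)$, and let $\mathcal L^\Delta:X\to\mathbb R^d$ ($\Delta>0$) be measurable maps with $\sup_\Delta\|\mathcal L^\Delta\|_{L^2(\mu_{\mathrm{prior}})}\le M$. Let $\mu^{\Delta,y}(d\bar u)=Z^\Delta(y)^{-1}\rho(y-\mathcal L^\Delta(\bar u))\,\mu_{\mathrm{prior}}(d\bar u)$ be the posterior of the associated Bayesian inverse problem. Then $\{y\mapsto\mu^{\Delta,y}\}_\Delta$ is pre-compact in $C_{\mathrm{loc}}(\mathbb R^d;\mathcal P_1(X))$ as $\Delta\to0$: for every $R>0$ there is $C=C(R,M,\rho)>0$ with $W_1(\mu^{\Delta,y},\mu^{\Delta,y'})\le C|y-y'|_\Gamma$ for all $|y|_\Gamma,|y'|_\Gamma\le R$ and all $\Delta$; and there is a subsequence $\Delta_k\to0$ and $\mu^{*,y}$ with $\sup_{|y|_\Gamma\le R}W_1(\mu^{\Delta_k,y},\mu^{*,y})\to0$ for every $R>0$. Any such limit is locally Lipschitz in $y$ and can be written $d\mu^{*,y}=Z^*(y)^{-1}\exp(-\Phi^*(\bar u))\,d\mu_{\mathrm{prior}}$ for a suitable functional $\Phi^*:X\to\mathbb R$.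
   Context: $\|\mathcal L^\Delta\|_{L^2(\mu_{\mathrm{prior}})}=(\int_X|\mathcal L^\Delta(\bar u)|_\Gamma^2\mu_{\mathrm{prior}}(d\bar u))^{1/2}$, with $|y|_\Gamma=\langle y,\Gamma^{-1}y\rangle^{1/2}$ for a fixed symmetric positive definite $\Gamma\in\mathbb R^{d\times d}$. $Z^\Delta(y)=\int_X\rho(y-\mathcal L^\Delta(\bar u))\mu_{\mathrm{prior}}(d\bar u)$. The noise density $\rho>0$ on $\mathbb R^d$ satisfies the standing assumptions (N.1) $|\rho(y)-\rho(y')|\le L_\rho|y-y'|_\Gamma$; (N.2) $\sup\rho<\infty$; (N.3) $\rho(y)\ge C^{-1}\exp(-\tfrac12|y|_\Gamma^2)$. $\mathcal P_1(X)$ is the space of Borel probability measures with finite first moment, metrized by the $1$-Wasserstein distance $W_1$; $C_{\mathrm{loc}}$ carries the topology of uniform convergence on compact sets.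
   Formalization: The functional Φ* is allowed to depend on y (otherwise the limit could not depend on y), and the constant C may also depend on the fixed prior (and Γ), since independence of the prior's first moment is false. *)

theory Defs
  imports "HOL-Probability.Probability"
begin

definition gnorm :: "real^'n^'n \<Rightarrow> real^'n \<Rightarrow> real" where
  "gnorm \<Gamma> y = sqrt (y \<bullet> (matrix_inv \<Gamma> *v y))"

definition sym_pos_def :: "real^'n^'n \<Rightarrow> bool" where
  "sym_pos_def \<Gamma> \<longleftrightarrow> transpose \<Gamma> = \<Gamma> \<and> (\<forall>x. x \<noteq> 0 \<longrightarrow> x \<bullet> (\<Gamma> *v x) > 0)"

definition noise_density :: "real^'n^'n \<Rightarrow> (real^'n \<Rightarrow> real) \<Rightarrow> bool" where
  "noise_density \<Gamma> \<rho> \<longleftrightarrow>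
     \<rho> \<in> borel_measurable borel \<and>
     (\<forall>y. \<rho> y > 0) \<and>
     (\<exists>L\<rho>. \<forall>y y'. \<bar>\<rho> y - \<rho> y'\<bar> \<le> L\<rho> * gnorm \<Gamma> (y - y')) \<and>
     (\<exists>B. \<forall>y. \<rho> y \<le> B) \<and>
     (\<exists>C>0. \<forall>y. \<rho> y \<ge> exp (- (gnorm \<Gamma> y)\<^sup>2 / 2) / C)"

definition P1 :: "'x::real_normed_vector measure \<Rightarrow> bool" where
  "P1 \<mu> \<longleftrightarrow> sets \<mu> = sets borel \<and> prob_space \<mu> \<and> (\<integral>\<^sup>+ u. ennreal (norm u) \<partial>\<mu>) < \<infinity>"

definition couplings :: "'x::metric_space measure \<Rightarrow> 'x measure \<Rightarrow> ('x \<times> 'x) measure set" where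
  "couplings \<mu> \<nu> = {\<pi>. sets \<pi> = sets (borel \<Otimes>\<^sub>M borel) \<and> prob_space \<pi> \<and>
                       distr \<pi> borel fst = \<mu> \<and> distr \<pi> borel snd = \<nu>}"

definition W1 :: "'x::metric_space measure \<Rightarrow> 'x measure \<Rightarrow> ennreal" where
  "W1 \<mu> \<nu> = (INF \<pi> \<in> couplings \<mu> \<nu>. \<integral>\<^sup>+ p. ennreal (dist (fst p) (snd p)) \<partial>\<pi>)"

definition admissible_family ::
  "real^'n^'n \<Rightarrow> 'x::real_normed_vector measure \<Rightarrow> real \<Rightarrow> (real \<Rightarrow> 'x \<Rightarrow> real^'n) \<Rightarrow> bool" where
  "admissible_family \<Gamma> \<mu> M L \<longleftrightarrow>
     (\<forall>\<Delta>>0. L \<Delta> \<in> borel_measurable borel \<and>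
        (\<integral>\<^sup>+ u. ennreal ((gnorm \<Gamma> (L \<Delta> u))\<^sup>2) \<partial>\<mu>) \<le> ennreal (M\<^sup>2))"

definition Zpost :: "'x measure \<Rightarrow> (real^'n \<Rightarrow> real) \<Rightarrow> ('x \<Rightarrow> real^'n) \<Rightarrow> real^'n \<Rightarrow> real" where
  "Zpost \<mu> \<rho> L y = (\<integral> u. \<rho> (y - L u) \<partial>\<mu>)"

definition posterior :: "'x measure \<Rightarrow> (real^'n \<Rightarrow> real) \<Rightarrow> ('x \<Rightarrow> real^'n) \<Rightarrow> real^'n \<Rightarrow> 'x measure" where
  "posterior \<mu> \<rho> L y = density \<mu> (\<lambda>u. ennreal (\<rho> (y - L u) / Zpost \<mu> \<rho> L y))"

end

theory Submission
  imports Defs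
begin

text \<open>
  On \<open>{y. gnorm \<Gamma> y \<le> R}\<close> the posteriors have densities with respect to the prior that are bounded and
  Lipschitz in \<open>y\<close>, uniformly over all admissible forward maps, because Chebyshev's inequality and the
  Gaussian lower bound on the noise bound the evidence away from 0.
  Coupling two measures cell by cell along a countable partition into small sets bounds \<open>W1\<close> by a weighted
  sum of the differences of the cell masses; refining the partition turns a density difference of at
  most \<open>c\<close> into \<open>W1 \<le> c * \<integral> norm u d\<mu>\<close>, which is the Lipschitz bound.

  For compactness, a diagonal argument over a countable dense set of data \<open>y\<close> and over finite unions of
  basic open sets gives a subsequence along which the posterior mass of every Borel set converges for
  every \<open>y\<close>; the limits are measures dominated by the prior. By the cell estimate this setwise convergence
  implies convergence in \<open>W1\<close>, uniformly on compact sets by equicontinuity. The limit charges every set of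
  positive prior mass, so its density is positive almost everywhere and has the form \<open>exp (- \<Phi>)\<close>.
  An arbitrary \<open>W1\<close> limit agrees with such a limit along a subsequence.
\<close>

subsection \<open>Couplings along a countable partition\<close>

text \<open>The forward maps are only measurable and bounded in mean square. They may oscillate as
  \<open>\<Delta>\<close> tends to 0, so along a subsequence one can expect weak convergence of the
  densities, but neither almost everywhere nor total variation convergence. This shapes the proof in
  two ways. A coupling built from the pointwise excess of one density over the other would need
  strong convergence; a coupling that sees only the masses of fixed cells needs convergence of those
  masses alone, with the tail of the weighted sum controlled by the first moment of the prior. And
  the limit potential cannot be read off as a limit of \<open>- ln (\<rho> (y - L u))\<close>: it
  comes from the Radon-Nikodym theorem, and for it to be real the lower bound is needed on every set
  of given prior mass, not just for the evidence. Domination by a multiple of the prior takes the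
  place of tightness: it prevents loss of mass and of first moments in the limit.\<close>

definition cell_kernel :: "(nat \<Rightarrow> real) \<Rightarrow> (nat \<Rightarrow> real) \<Rightarrow> nat \<Rightarrow> nat \<Rightarrow> real" where
  "cell_kernel a b i j = of_bool (i = j) * (min (a i) (b i) / (a i * b i)) +
     (1 - min (a i) (b i) / a i) * (1 - min (a j) (b j) / b j) / (1 - (\<Sum>l. min (a l) (b l)))"

text \<open>
  If \<open>a\<close> and \<open>b\<close> are the cell masses of \<open>P\<close> and \<open>Q\<close>, the kernel, read on the indices of the cells of two points,
  is the density with respect to \<open>P \<Otimes> Q\<close> of the coupling that transports \<open>min (a i) (b i)\<close> within cell \<open>i\<close>
  and couples the excess masses independently. Division by zero only occurs on null cells, or when
  there is no excess mass, in which case the junk value 0 is the right one.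
\<close>

lemma cell_kernel_swap: "cell_kernel a b i j = cell_kernel b a j i"
  by (auto simp: cell_kernel_def min.commute mult.commute)

text \<open>Given that the first point lies in cell \<open>i\<close>, the fraction
  \<open>min (a i) (b i) / a i\<close> stays in that cell, and the rest is spread over the cells in
  proportion to the excess \<open>b j - min (a j) (b j)\<close>, whose total is
  \<open>1 - (\<Sum>l. min (a l) (b l))\<close>. These conditional masses add up to 1.\<close>

lemma
  fixes a b :: "nat \<Rightarrow> real"
  assumes a: "\<And>i. 0 \<le> a i" "a sums 1" and b: "\<And>i. 0 \<le> b i" "b sums 1"
  shows summable_min_cells: "summable (\<lambda>i. min (a i) (b i))"
    and suminf_min_cells_le: "(\<Sum>i. min (a i) (b i)) \<le> 1"
    and cell_kernel_nonneg: "0 \<le> cell_kernel a b i j"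
    and cell_kernel_row_sum: "0 < a i \<Longrightarrow> (\<lambda>j. cell_kernel a b i j * b j) sums 1"
proof -
  let ?m = "\<lambda>i. min (a i) (b i)"
  let ?r = "1 - (\<Sum>l. ?m l)"
  show S: "summable ?m"
    by (rule summable_comparison_test[OF _ sums_summable[OF a(2)]]) (auto intro!: exI[of _ 0] simp: a b)
  show le: "(\<Sum>i. ?m i) \<le> 1"
    using suminf_le[OF _ S sums_summable[OF a(2)]] sums_unique[OF a(2)] by simp
  have f: "?m i / a i \<le> 1" "?m i / b i \<le> 1" for i
    using a(1)[of i] b(1)[of i] by (auto simp: divide_le_eq_1)
  show "0 \<le> cell_kernel a b i j"
    unfolding cell_kernel_def using f le a(1) b(1)
    by (intro add_nonneg_nonneg mult_nonneg_nonneg divide_nonneg_nonneg) auto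
  assume i: "0 < a i"
  have bm: "(1 - ?m j / b j) * b j = b j - ?m j" for j
    using a(1)[of j] b(1)[of j] by (cases "b j = 0") (auto simp: algebra_simps)
  have am: "(1 - ?m j / a j) * a j = a j - ?m j" for j
    using a(1)[of j] b(1)[of j] by (cases "a j = 0") (auto simp: algebra_simps)
  have s1: "(\<lambda>j. of_bool (i = j) * (?m i / (a i * b i)) * b j) sums (?m i / (a i * b i) * b i)"
    using sums_single[of i "\<lambda>j. ?m i / (a i * b i) * b j"]
    by (rule sums_cong[THEN iffD1, rotated]) auto
  have s2: "(\<lambda>j. (1 - ?m i / a i) / ?r * (b j - ?m j)) sums ((1 - ?m i / a i) / ?r * ?r)"
    by (intro sums_mult sums_diff b(2) summable_sums S)
  \<comment> \<open>Without excess mass the nonnegative terms \<open>a j - ?m j\<close> sum to 0, so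
    each of them vanishes. Then \<open>1 - ?m i / a i\<close> is 0, in agreement with the default
    value of the quotient by \<open>?r\<close>.\<close>
  have r0: "?m i / a i = 1" if "?r = 0"
  proof -
    have "(\<lambda>j. a j - ?m j) sums 0"
      using sums_diff[OF a(2) summable_sums[OF S]] that by simp
    then have "a i - ?m i = 0"
      using suminf_eq_zero_iff[of "\<lambda>j. a j - ?m j"] by (auto simp: sums_iff)
    with i show ?thesis by simp
  qed
  have "?m i / (a i * b i) * b i = ?m i / a i"
    using a(1)[of i] b(1)[of i] by (cases "b i = 0") auto
  moreover have "(1 - ?m i / a i) / ?r * ?r = 1 - ?m i / a i"
    using r0 by (cases "?r = 0") auto
  ultimately have "?m i / (a i * b i) * b i + (1 - ?m i / a i) / ?r * ?r = 1" by simp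
  moreover have "cell_kernel a b i j * b j = of_bool (i = j) * (?m i / (a i * b i)) * b j
      + (1 - ?m i / a i) / ?r * (b j - ?m j)" for j
    unfolding cell_kernel_def by (simp add: bm[symmetric] algebra_simps)
  ultimately show "(\<lambda>j. cell_kernel a b i j * b j) sums 1"
    using sums_add[OF s1 s2] by simp
qed

section \<open>Integrals of functions of a countable cell index\<close>

lemma nn_integral_cells:
  assumes [measurable]: "T \<in> M \<rightarrow>\<^sub>M count_space (UNIV :: nat set)"
  shows "(\<integral>\<^sup>+u. \<phi> (T u) \<partial>M) = (\<Sum>i. \<phi> i * emeasure M (T -` {i} \<inter> space M))"
proof -
  have [measurable]: "T -` {i} \<inter> space M \<in> sets M" for i
    by (rule measurable_sets[OF assms]) simp
  have "(\<integral>\<^sup>+u. \<phi> (T u) \<partial>M) = (\<integral>\<^sup>+u. (\<Sum>i. \<phi> i * indicator (T -` {i} \<inter> space M) u) \<partial>M)"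
  proof (rule nn_integral_cong)
    fix u assume u: "u \<in> space M"
    have "(\<Sum>i. \<phi> i * indicator (T -` {i} \<inter> space M) u) = (\<Sum>i\<in>{T u}. \<phi> i * indicator (T -` {i} \<inter> space M) u)"
      by (rule suminf_finite) auto
    then show "\<phi> (T u) = (\<Sum>i. \<phi> i * indicator (T -` {i} \<inter> space M) u)" using u by simp
  qed
  also have "\<dots> = (\<Sum>i. \<integral>\<^sup>+u. \<phi> i * indicator (T -` {i} \<inter> space M) u \<partial>M)"
    by (rule nn_integral_suminf) measurable
  also have "\<dots> = (\<Sum>i. \<phi> i * emeasure M (T -` {i} \<inter> space M))"
    by (subst nn_integral_cmult_indicator) auto
  finally show ?thesis .
qed

lemma (in prob_space) cells_sums_one:
  assumes [measurable]: "T \<in> M \<rightarrow>\<^sub>M count_space (UNIV :: nat set)"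
  shows "(\<lambda>i. prob (T -` {i} \<inter> space M)) sums 1"
proof -
  have "(\<lambda>i. prob (T -` {i} \<inter> space M)) sums prob (\<Union>i. T -` {i} \<inter> space M)"
    by (rule finite_measure_UNION) (auto simp: disjoint_family_on_def)
  also have "(\<Union>i. T -` {i} \<inter> space M) = space M" by auto
  finally show ?thesis by (simp add: prob_space)
qed

text \<open>There are countably many null cells, so their union is null.\<close>

lemma (in prob_space) AE_cell_pos:
  assumes [measurable]: "T \<in> M \<rightarrow>\<^sub>M count_space (UNIV :: nat set)"
  shows "AE u in M. 0 < prob (T -` {T u} \<inter> space M)"
proof -
  have "(\<integral>\<^sup>+u. of_bool (prob (T -` {T u} \<inter> space M) = 0) \<partial>M) = 0"
    by (subst nn_integral_cells[where \<phi> = "\<lambda>i. of_bool (prob (T -` {i} \<inter> space M) = 0)"])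
       (auto simp: emeasure_eq_measure suminf_eq_zero_iff of_bool_def)
  then have "AE u in M. (of_bool (prob (T -` {T u} \<inter> space M) = 0) :: ennreal) = 0"
    by (subst (asm) nn_integral_0_iff_AE) auto
  then show ?thesis by eventually_elim (auto simp: zero_less_measure_iff)
qed

text \<open>Only almost everywhere: the row of a null cell of \<open>P\<close> need not sum to 1,
  but such cells are hit with probability 0.\<close>

lemma nn_integral_cell_kernel:
  assumes P: "prob_space P" and Q: "prob_space Q"
    and TP [measurable]: "T \<in> P \<rightarrow>\<^sub>M count_space (UNIV :: nat set)"
    and TQ [measurable]: "T \<in> Q \<rightarrow>\<^sub>M count_space (UNIV :: nat set)"
  shows "AE u in P. (\<integral>\<^sup>+v. ennreal (cell_kernel (\<lambda>i. measure P (T -` {i} \<inter> space P))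
    (\<lambda>i. measure Q (T -` {i} \<inter> space Q)) (T u) (T v)) \<partial>Q) = 1"
proof -
  interpret P: prob_space P by fact
  interpret Q: prob_space Q by fact
  let ?a = "\<lambda>i. measure P (T -` {i} \<inter> space P)" and ?b = "\<lambda>i. measure Q (T -` {i} \<inter> space Q)"
  note * = P.cells_sums_one[OF TP] Q.cells_sums_one[OF TQ]
  have "(\<integral>\<^sup>+v. ennreal (cell_kernel ?a ?b i (T v)) \<partial>Q) = 1" if "0 < ?a i" for i
  proof -
    have "(\<integral>\<^sup>+v. ennreal (cell_kernel ?a ?b i (T v)) \<partial>Q) = (\<Sum>j. ennreal (cell_kernel ?a ?b i j * ?b j))"
      using cell_kernel_nonneg[OF _ *(1) _ *(2)]
      by (subst nn_integral_cells[OF TQ]) (simp add: Q.emeasure_eq_measure ennreal_mult)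
    also have "\<dots> = 1"
      using cell_kernel_row_sum[OF _ *(1) _ *(2) that] cell_kernel_nonneg[OF _ *(1) _ *(2)]
      by (subst suminf_ennreal_eq[where x = 1]) auto
    finally show ?thesis .
  qed
  with P.AE_cell_pos[OF TP] show ?thesis by (auto elim!: eventually_mono)
qed

text \<open>Pairs in the same cell cost at most \<open>\<epsilon>\<close>. A pair in different cells
  \<open>i\<close> and \<open>j\<close> is routed through the origin and costs at most
  \<open>s i + s j\<close>. Only excess mass travels this way, so integrating out the partner leaves
  \<open>s i\<close> times the excess of each measure in cell \<open>i\<close>, and the two excesses
  add up to the absolute difference of the cell masses.\<close>

lemma W1_le_cells:
  fixes P Q :: "'x::{real_normed_vector, second_countable_topology} measure"
  assumes P: "prob_space P" and sP [measurable_cong]: "sets P = sets borel"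
    and Q: "prob_space Q" and sQ [measurable_cong]: "sets Q = sets borel"
    and T [measurable]: "T \<in> borel \<rightarrow>\<^sub>M count_space (UNIV :: nat set)"
    and diam: "\<And>u v. T u = T v \<Longrightarrow> dist u v \<le> \<epsilon>" and s: "\<And>u. norm u \<le> s (T u)"
      "\<And>i. 0 \<le> s i"
    and \<epsilon>: "0 \<le> \<epsilon>"
  shows "W1 P Q \<le> ennreal \<epsilon> +
    (\<Sum>i. ennreal (\<bar>measure P (T -` {i}) - measure Q (T -` {i})\<bar> * s i))"
proof -
  interpret P: prob_space P by fact
  interpret Q: prob_space Q by fact
  interpret pair_sigma_finite P Q ..
  have spP [simp]: "space P = UNIV" and spQ [simp]: "space Q = UNIV"
    using sets_eq_imp_space_eq[OF sP] sets_eq_imp_space_eq[OF sQ] by simp_all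
  have TP [measurable]: "T \<in> P \<rightarrow>\<^sub>M count_space UNIV" and TQ [measurable]: "T \<in> Q \<rightarrow>\<^sub>M count_space UNIV"
    by measurable
  define a b where "a i = measure P (T -` {i})" and "b i = measure Q (T -` {i})" for i
  have a: "\<And>i. 0 \<le> a i" "a sums 1" and b: "\<And>i. 0 \<le> b i" "b sums 1"
    using P.cells_sums_one[OF TP] Q.cells_sums_one[OF TQ] by (auto simp: a_def[abs_def] b_def[abs_def])
  let ?m = "\<lambda>i. min (a i) (b i)"
  define r where "r = 1 - (\<Sum>l. ?m l)"
  have r: "0 \<le> r" using suminf_min_cells_le[OF a b] by (simp add: r_def)
  have sumam: "(\<lambda>j. a j - ?m j) sums r" and sumbm: "(\<lambda>j. b j - ?m j) sums r"
    unfolding r_def by (intro sums_diff a b summable_sums summable_min_cells)+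
  define k where "k = cell_kernel a b"
  have k0: "0 \<le> k i j" for i j
    unfolding k_def by (rule cell_kernel_nonneg[OF a b])
  \<comment> \<open>\<open>\<alpha> i\<close> and \<open>\<beta> i\<close> are the fractions of the
    two masses of cell \<open>i\<close> that are in excess. \<open>w\<close> is the independent part
    of the kernel, which is the whole kernel off the diagonal.\<close>
  define \<alpha> \<beta> where "\<alpha> i = 1 - ?m i / a i" and "\<beta> i = 1 - ?m i / b i" for i
  define w where "w i j = \<alpha> i * \<beta> j / r" for i j
  have \<alpha>0: "0 \<le> \<alpha> i" and \<beta>0: "0 \<le> \<beta> i" for i
    using a(1)[of i] b(1)[of i] by (auto simp: \<alpha>_def \<beta>_def divide_le_eq_1)
  have w0: "0 \<le> w i j" for i j
    using \<alpha>0 \<beta>0 r by (simp add: w_def)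
  have \<alpha>a: "\<alpha> i * a i = a i - ?m i" and \<beta>b: "\<beta> i * b i = b i - ?m i" for i
    using a(1)[of i] b(1)[of i] by (cases "a i = 0"; cases "b i = 0"; simp add: \<alpha>_def \<beta>_def algebra_simps)+
  \<comment> \<open>Multiplying \<open>w\<close> by the mass of a cell turns the excess fraction of
    that cell into the excess itself, null cells included.\<close>
  have e: "ennreal (s i * w i j) * ennreal (b j) = ennreal ((s i * \<alpha> i / r) * (b j - ?m j))"
      "ennreal (s j * w i j) * ennreal (a i) = ennreal ((s j * \<beta> j / r) * (a i - ?m i))"
      "ennreal (s i * \<alpha> i) * ennreal (a i) = ennreal (s i * (a i - ?m i))"
      "ennreal (s i * \<beta> i) * ennreal (b i) = ennreal (s i * (b i - ?m i))" for i j
  proof -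
    have 1: "s i * w i j * b j = (s i * \<alpha> i / r) * (b j - ?m j)"
      "s j * w i j * a i = (s j * \<beta> j / r) * (a i - ?m i)"
      "s i * \<alpha> i * a i = s i * (a i - ?m i)" "s i * \<beta> i * b i = s i * (b i - ?m i)"
      by (simp_all add: \<alpha>a[symmetric] \<beta>b[symmetric] w_def)
    show "ennreal (s i * w i j) * ennreal (b j) = ennreal ((s i * \<alpha> i / r) * (b j - ?m j))"
      "ennreal (s j * w i j) * ennreal (a i) = ennreal ((s j * \<beta> j / r) * (a i - ?m i))"
      "ennreal (s i * \<alpha> i) * ennreal (a i) = ennreal (s i * (a i - ?m i))"
      "ennreal (s i * \<beta> i) * ennreal (b i) = ennreal (s i * (b i - ?m i))"
      unfolding 1[symmetric]
      by (rule ennreal_mult[symmetric]; intro mult_nonneg_nonneg s(2) w0 \<alpha>0 \<beta>0 a(1) b(1))+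
  qed
  have km [measurable]: "(\<lambda>p. ennreal (k (T (fst p)) (T (snd p)))) \<in> borel_measurable (P \<Otimes>\<^sub>M Q)"
    by measurable
  have rowP: "AE u in P. (\<integral>\<^sup>+v. ennreal (k (T u) (T v)) \<partial>Q) = 1"
    using nn_integral_cell_kernel[OF P Q TP TQ] by (simp add: k_def a_def[abs_def] b_def[abs_def])
  \<comment> \<open>Exchanging the two measures transposes the kernel, so the row sums of the
    exchanged kernel are the column sums wanted here.\<close>
  have rowQ: "AE v in Q. (\<integral>\<^sup>+u. ennreal (k (T u) (T v)) \<partial>P) = 1"
    using nn_integral_cell_kernel[OF Q P TQ TP]
    unfolding k_def cell_kernel_swap[of a b] by (simp add: a_def[abs_def] b_def[abs_def])
  define \<pi> where "\<pi> = density (P \<Otimes>\<^sub>M Q) (\<lambda>p. ennreal (k (T (fst p)) (T (snd p))))"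
  have s\<pi>: "sets \<pi> = sets (borel \<Otimes>\<^sub>M borel)"
    unfolding \<pi>_def using sets_pair_measure_cong[OF sP sQ] by simp
  have m1: "distr \<pi> borel fst = P"
  proof (rule measure_eqI)
    fix A assume "A \<in> sets (distr \<pi> borel fst)"
    then have [measurable]: "A \<in> sets borel" by simp
    have "emeasure (distr \<pi> borel fst) A = emeasure \<pi> (fst -` A \<inter> space \<pi>)"
      by (rule emeasure_distr) (auto simp: measurable_cong_sets[OF s\<pi> refl])
    also have "\<dots> = (\<integral>\<^sup>+p. ennreal (k (T (fst p)) (T (snd p))) * indicator A (fst p) \<partial>(P \<Otimes>\<^sub>M Q))"
    proof -
      have "fst -` A \<inter> space (P \<Otimes>\<^sub>M Q) \<in> sets (P \<Otimes>\<^sub>M Q)"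
        by (rule measurable_sets[OF measurable_fst]) (simp add: sP)
      then show ?thesis unfolding \<pi>_def
        by (subst emeasure_density) (auto intro!: nn_integral_cong simp: space_pair_measure split: split_indicator)
    qed
    also have "\<dots> = (\<integral>\<^sup>+u. (\<integral>\<^sup>+v. ennreal (k (T u) (T v)) \<partial>Q) * indicator A u \<partial>P)"
      by (subst Q.nn_integral_fst[symmetric]) (auto simp: nn_integral_multc)
    also have "\<dots> = (\<integral>\<^sup>+u. indicator A u \<partial>P)"
      using rowP by (intro nn_integral_cong_AE) auto
    also have "\<dots> = emeasure P A" by (simp add: sP)
    finally show "emeasure (distr \<pi> borel fst) A = emeasure P A" .
  qed (simp add: sP)
  have m2: "distr \<pi> borel snd = Q"
  proof (rule measure_eqI)
    fix A assume "A \<in> sets (distr \<pi> borel snd)"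
    then have [measurable]: "A \<in> sets borel" by simp
    have "emeasure (distr \<pi> borel snd) A = emeasure \<pi> (snd -` A \<inter> space \<pi>)"
      by (rule emeasure_distr) (auto simp: measurable_cong_sets[OF s\<pi> refl])
    also have "\<dots> = (\<integral>\<^sup>+p. ennreal (k (T (fst p)) (T (snd p))) * indicator A (snd p) \<partial>(P \<Otimes>\<^sub>M Q))"
    proof -
      have "snd -` A \<inter> space (P \<Otimes>\<^sub>M Q) \<in> sets (P \<Otimes>\<^sub>M Q)"
        by (rule measurable_sets[OF measurable_snd]) (simp add: sQ)
      then show ?thesis unfolding \<pi>_def
        by (subst emeasure_density) (auto intro!: nn_integral_cong simp: space_pair_measure split: split_indicator)
    qed
    also have "\<dots> = (\<integral>\<^sup>+v. (\<integral>\<^sup>+u. ennreal (k (T u) (T v)) \<partial>P) * indicator A v \<partial>Q)"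
      by (subst nn_integral_snd[symmetric]) (auto simp: nn_integral_multc)
    also have "\<dots> = (\<integral>\<^sup>+v. indicator A v \<partial>Q)"
      using rowQ by (intro nn_integral_cong_AE) auto
    also have "\<dots> = emeasure Q A" by (simp add: sQ)
    finally show "emeasure (distr \<pi> borel snd) A = emeasure Q A" .
  qed (simp add: sQ)
  have "prob_space \<pi>"
  proof -
    have "prob_space (distr \<pi> borel fst)" using m1 P by simp
    then show ?thesis
      by (rule prob_space_distrD[rotated]) (auto simp: measurable_cong_sets[OF s\<pi> refl])
  qed
  with s\<pi> m1 m2 have "\<pi> \<in> couplings P Q" by (simp add: couplings_def)
  then have "W1 P Q \<le> (\<integral>\<^sup>+p. ennreal (dist (fst p) (snd p)) \<partial>\<pi>)"
    unfolding W1_def by (rule INF_lower)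
  also have "\<dots> = (\<integral>\<^sup>+p. ennreal (k (T (fst p)) (T (snd p))) * ennreal (dist (fst p) (snd p)) \<partial>(P \<Otimes>\<^sub>M Q))"
    unfolding \<pi>_def by (subst nn_integral_density) auto
  also have "\<dots> \<le> (\<integral>\<^sup>+p. ennreal \<epsilon> * ennreal (k (T (fst p)) (T (snd p)))
      + (ennreal (s (T (fst p)) * w (T (fst p)) (T (snd p)))
      + ennreal (s (T (snd p)) * w (T (fst p)) (T (snd p)))) \<partial>(P \<Otimes>\<^sub>M Q))"
  proof (intro nn_integral_mono)
    fix p :: "'x \<times> 'x"
    obtain u v where p: "p = (u, v)" by (cases p)
    have "k (T u) (T v) * dist u v \<le> \<epsilon> * k (T u) (T v) + (s (T u) * w (T u) (T v) + s (T v) * w (T u) (T v))"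
    proof (cases "T u = T v")
      case True
      then have "k (T u) (T v) * dist u v \<le> k (T u) (T v) * \<epsilon>"
        by (intro mult_left_mono diam k0)
      also have "\<dots> \<le> \<epsilon> * k (T u) (T v) + (s (T u) * w (T u) (T v) + s (T v) * w (T u) (T v))"
        using s(2) w0 by simp
      finally show ?thesis .
    next
      case False
      then have kw: "k (T u) (T v) = w (T u) (T v)"
        by (simp add: k_def w_def \<alpha>_def \<beta>_def r_def cell_kernel_def)
      have "dist u v \<le> norm u + norm v" by (simp add: dist_norm norm_triangle_ineq4)
      also have "\<dots> \<le> s (T u) + s (T v)" by (intro add_mono s)
      finally have "w (T u) (T v) * dist u v \<le> w (T u) (T v) * (s (T u) + s (T v))"
        by (rule mult_left_mono[OF _ w0])
      moreover have "0 \<le> \<epsilon> * w (T u) (T v)" using \<epsilon> w0 by simp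
      ultimately show ?thesis unfolding kw by (simp add: algebra_simps)
    qed
    then have "ennreal (k (T u) (T v) * dist u v) \<le>
        ennreal (\<epsilon> * k (T u) (T v) + (s (T u) * w (T u) (T v) + s (T v) * w (T u) (T v)))"
      by (rule ennreal_leI)
    then show "ennreal (k (T (fst p)) (T (snd p))) * ennreal (dist (fst p) (snd p)) \<le>
        ennreal \<epsilon> * ennreal (k (T (fst p)) (T (snd p))) + (ennreal (s (T (fst p)) * w (T (fst p)) (T (snd p)))
      + ennreal (s (T (snd p)) * w (T (fst p)) (T (snd p))))"
      using \<epsilon> k0 w0 s(2) by (simp add: p ennreal_mult)
  qed
  also have "\<dots> = ennreal \<epsilon> * (\<integral>\<^sup>+p. ennreal (k (T (fst p)) (T (snd p))) \<partial>(P \<Otimes>\<^sub>M Q))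
      + ((\<integral>\<^sup>+p. ennreal (s (T (fst p)) * w (T (fst p)) (T (snd p))) \<partial>(P \<Otimes>\<^sub>M Q))
      + (\<integral>\<^sup>+p. ennreal (s (T (snd p)) * w (T (fst p)) (T (snd p))) \<partial>(P \<Otimes>\<^sub>M Q)))"
    by (simp add: nn_integral_add nn_integral_cmult)
  finally have W: "W1 P Q \<le> ennreal \<epsilon> * (\<integral>\<^sup>+p. ennreal (k (T (fst p)) (T (snd p))) \<partial>(P \<Otimes>\<^sub>M Q))
      + ((\<integral>\<^sup>+p. ennreal (s (T (fst p)) * w (T (fst p)) (T (snd p))) \<partial>(P \<Otimes>\<^sub>M Q))
      + (\<integral>\<^sup>+p. ennreal (s (T (snd p)) * w (T (fst p)) (T (snd p))) \<partial>(P \<Otimes>\<^sub>M Q)))" .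
  have I1: "(\<integral>\<^sup>+p. ennreal (k (T (fst p)) (T (snd p))) \<partial>(P \<Otimes>\<^sub>M Q)) = 1"
  proof -
    have "(\<integral>\<^sup>+p. ennreal (k (T (fst p)) (T (snd p))) \<partial>(P \<Otimes>\<^sub>M Q)) = (\<integral>\<^sup>+u. (\<integral>\<^sup>+v. ennreal (k (T u) (T v)) \<partial>Q) \<partial>P)"
      by (subst Q.nn_integral_fst[symmetric]) auto
    also have "\<dots> = (\<integral>\<^sup>+u. 1 \<partial>P)"
      by (rule nn_integral_cong_AE[OF rowP])
    finally show ?thesis by (simp add: P.emeasure_space_1[simplified])
  qed
  have I2: "(\<integral>\<^sup>+p. ennreal (s (T (fst p)) * w (T (fst p)) (T (snd p))) \<partial>(P \<Otimes>\<^sub>M Q))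
      \<le> (\<Sum>i. ennreal (s i * (a i - ?m i)))"
  proof -
    have "(\<integral>\<^sup>+p. ennreal (s (T (fst p)) * w (T (fst p)) (T (snd p))) \<partial>(P \<Otimes>\<^sub>M Q))
       = (\<integral>\<^sup>+u. (\<integral>\<^sup>+v. ennreal (s (T u) * w (T u) (T v)) \<partial>Q) \<partial>P)"
      by (subst Q.nn_integral_fst[symmetric]) auto
    also have "\<dots> \<le> (\<integral>\<^sup>+u. ennreal (s (T u) * \<alpha> (T u)) \<partial>P)"
    proof (rule nn_integral_mono)
      fix u
      have "(\<integral>\<^sup>+v. ennreal (s (T u) * w (T u) (T v)) \<partial>Q)
          = (\<Sum>j. ennreal ((s (T u) * \<alpha> (T u) / r) * (b j - ?m j)))"
        by (subst nn_integral_cells[OF TQ, of "\<lambda>j. ennreal (s (T u) * w (T u) j)"])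
          (simp add: Q.emeasure_eq_measure b_def[symmetric] e)
      also have "\<dots> = ennreal (s (T u) * \<alpha> (T u) / r * r)"
        using s(2) \<alpha>0 r by (intro suminf_ennreal_eq sums_mult sumbm) (auto intro!: mult_nonneg_nonneg divide_nonneg_nonneg)
      \<comment> \<open>An inequality is all that holds in general: for \<open>r = 0\<close> the
        left side is 0, whereas \<open>\<alpha>\<close> is 1 on a null cell.\<close>
      also have "\<dots> \<le> ennreal (s (T u) * \<alpha> (T u))"
        using s(2) \<alpha>0 by (cases "r = 0") auto
      finally show "(\<integral>\<^sup>+v. ennreal (s (T u) * w (T u) (T v)) \<partial>Q) \<le> ennreal (s (T u) * \<alpha> (T u))" .
    qed
    also have "\<dots> = (\<Sum>i. ennreal (s i * (a i - ?m i)))"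
      by (subst nn_integral_cells[OF TP, of "\<lambda>i. ennreal (s i * \<alpha> i)"])
          (simp add: P.emeasure_eq_measure a_def[symmetric] e)
    finally show ?thesis .
  qed
  have I3: "(\<integral>\<^sup>+p. ennreal (s (T (snd p)) * w (T (fst p)) (T (snd p))) \<partial>(P \<Otimes>\<^sub>M Q))
      \<le> (\<Sum>i. ennreal (s i * (b i - ?m i)))"
  proof -
    have "(\<integral>\<^sup>+p. ennreal (s (T (snd p)) * w (T (fst p)) (T (snd p))) \<partial>(P \<Otimes>\<^sub>M Q))
       = (\<integral>\<^sup>+v. (\<integral>\<^sup>+u. ennreal (s (T v) * w (T u) (T v)) \<partial>P) \<partial>Q)"
      by (subst nn_integral_snd[symmetric]) auto
    also have "\<dots> \<le> (\<integral>\<^sup>+v. ennreal (s (T v) * \<beta> (T v)) \<partial>Q)"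
    proof (rule nn_integral_mono)
      fix v
      have "(\<integral>\<^sup>+u. ennreal (s (T v) * w (T u) (T v)) \<partial>P)
          = (\<Sum>j. ennreal ((s (T v) * \<beta> (T v) / r) * (a j - ?m j)))"
        by (subst nn_integral_cells[OF TP, of "\<lambda>i. ennreal (s (T v) * w i (T v))"])
          (simp add: P.emeasure_eq_measure a_def[symmetric] e)
      also have "\<dots> = ennreal (s (T v) * \<beta> (T v) / r * r)"
        using s(2) \<beta>0 r by (intro suminf_ennreal_eq sums_mult sumam) (auto intro!: mult_nonneg_nonneg divide_nonneg_nonneg)
      also have "\<dots> \<le> ennreal (s (T v) * \<beta> (T v))"
        using s(2) \<beta>0 by (cases "r = 0") auto
      finally show "(\<integral>\<^sup>+u. ennreal (s (T v) * w (T u) (T v)) \<partial>P) \<le> ennreal (s (T v) * \<beta> (T v))" .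
    qed
    also have "\<dots> = (\<Sum>i. ennreal (s i * (b i - ?m i)))"
      by (subst nn_integral_cells[OF TQ, of "\<lambda>i. ennreal (s i * \<beta> i)"])
          (simp add: Q.emeasure_eq_measure b_def[symmetric] e)
    finally show ?thesis .
  qed
  have I4: "(\<Sum>i. ennreal (s i * (a i - ?m i))) + (\<Sum>i. ennreal (s i * (b i - ?m i)))
      = (\<Sum>i. ennreal (\<bar>a i - b i\<bar> * s i))"
  proof -
    have "ennreal (s i * (a i - ?m i)) + ennreal (s i * (b i - ?m i)) = ennreal (\<bar>a i - b i\<bar> * s i)" for i
      using s(2)[of i] by (subst ennreal_plus[symmetric]) (auto simp: min_def algebra_simps abs_if intro!: mult_right_mono)
    then show ?thesis by (subst suminf_add) auto
  qed
  have "W1 P Q \<le> ennreal \<epsilon> + (\<Sum>i. ennreal (\<bar>a i - b i\<bar> * s i))"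
    using W add_mono[OF order_refl[of "ennreal \<epsilon>"] add_mono[OF I2 I3]] unfolding I1 I4
    by (simp add: order_trans)
  then show ?thesis by (simp add: a_def b_def)
qed


section \<open>Cells of small diameter and the resulting Wasserstein bound\<close>

lemma ex_small_cells:
  fixes \<epsilon> :: real
  assumes \<epsilon>: "0 < \<epsilon>"
  obtains T :: "'x::{real_normed_vector, second_countable_topology} \<Rightarrow> nat" and s :: "nat \<Rightarrow> real"
  where "T \<in> borel \<rightarrow>\<^sub>M count_space UNIV" "\<And>u v. T u = T v \<Longrightarrow> dist u v \<le> \<epsilon>"
    "\<And>u. norm u \<le> s (T u)" "\<And>i. 0 \<le> s i" "\<And>u. s (T u) \<le> norm u + \<epsilon>"
proof -
  obtain D :: "'x set" where D: "countable D" "\<And>X. open X \<Longrightarrow> X \<noteq> {} \<Longrightarrow> \<exists>d\<in>D. d \<in> X"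
    using countable_dense_setE by metis
  have "D \<noteq> {}" using D(2)[of UNIV] by auto
  define d where "d = from_nat_into D"
  have ex: "\<exists>i. dist u (d i) < \<epsilon> / 2" for u
  proof -
    obtain x where "x \<in> D" "x \<in> ball u (\<epsilon> / 2)" using D(2)[of "ball u (\<epsilon> / 2)"] \<epsilon> by auto
    then show ?thesis using from_nat_into_surj[OF D(1)] by (force simp: d_def)
  qed
  \<comment> \<open>Taking the first admissible index makes the cells disjoint and measurable at
    once.\<close>
  define T where "T u = (LEAST i. dist u (d i) < \<epsilon> / 2)" for u
  have T: "dist u (d (T u)) < \<epsilon> / 2" for u
    unfolding T_def using ex by (rule LeastI_ex)
  show thesis
  proof (rule that)
    show "T \<in> borel \<rightarrow>\<^sub>M count_space UNIV" unfolding T_def by measurable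
    show "dist u v \<le> \<epsilon>" if "T u = T v" for u v
      using T[of u] T[of v] that dist_triangle2[of u v "d (T v)"] by auto
    \<comment> \<open>The radius is read off the centre of the cell, so that it depends on the index
      alone. The centre is within \<open>\<epsilon> / 2\<close> of \<open>u\<close>, and the added
      slack \<open>\<epsilon> / 2\<close> brings the overshoot to at most
      \<open>\<epsilon>\<close>.\<close>
    show "norm u \<le> norm (d (T u)) + \<epsilon> / 2" for u
      using T[of u] norm_triangle_ineq2[of u "d (T u)"] by (simp add: dist_norm)
    show "0 \<le> norm (d i) + \<epsilon> / 2" for i using \<epsilon> by simp
    show "norm (d (T u)) + \<epsilon> / 2 \<le> norm u + \<epsilon>" for u
      using T[of u] norm_triangle_ineq2[of "d (T u)" u] by (simp add: dist_norm norm_minus_commute)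
  qed
qed

text \<open>The sum is the integral of the step function \<open>s (T u)\<close>, which exceeds the
  norm by at most \<open>\<epsilon>\<close>. A finite first moment thus makes the weighted cell
  masses summable.\<close>

lemma cells_radius_le:
  fixes \<mu> :: "'x::{real_normed_vector, second_countable_topology} measure"
  assumes "prob_space \<mu>" and s\<mu> [measurable_cong]: "sets \<mu> = sets borel"
    and T: "T \<in> borel \<rightarrow>\<^sub>M count_space (UNIV :: nat set)"
    and s: "\<And>u. s (T u) \<le> norm u + \<epsilon>" "\<And>i. 0 \<le> s i" and \<epsilon>: "0 \<le> \<epsilon>"
  shows "(\<Sum>i. ennreal (measure \<mu> (T -` {i}) * s i)) \<le> (\<integral>\<^sup>+u. ennreal (norm u) \<partial>\<mu>) + ennreal \<epsilon>"
proof -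
  interpret prob_space \<mu> by fact
  have sp: "space \<mu> = UNIV" using sets_eq_imp_space_eq[OF s\<mu>] by simp
  have T': "T \<in> \<mu> \<rightarrow>\<^sub>M count_space UNIV" using T by measurable
  have "(\<Sum>i. ennreal (measure \<mu> (T -` {i}) * s i)) = (\<integral>\<^sup>+u. ennreal (s (T u)) \<partial>\<mu>)"
    using s(2) by (subst nn_integral_cells[OF T']) (simp add: sp emeasure_eq_measure ennreal_mult mult.commute)
  also have "\<dots> \<le> (\<integral>\<^sup>+u. ennreal (norm u) + ennreal \<epsilon> \<partial>\<mu>)"
    using s(1) \<epsilon> by (intro nn_integral_mono) (simp add: ennreal_plus[symmetric] ennreal_leI del: ennreal_plus)
  also have "\<dots> = (\<integral>\<^sup>+u. ennreal (norm u) \<partial>\<mu>) + ennreal \<epsilon>"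
    using emeasure_space_1 by (subst nn_integral_add) auto
  finally show ?thesis .
qed

text \<open>With each cell difference at most \<open>c\<close> times the prior mass of the cell, the
  weighted sum becomes \<open>c\<close> times an approximation of the first moment. Letting the cell
  size tend to 0 removes the remaining errors.\<close>

lemma W1_le_of_measure_diff_le:
  fixes \<mu> :: "'x::{real_normed_vector, second_countable_topology} measure"
  assumes \<mu>: "P1 \<mu>"
    and P: "prob_space P" "sets P = sets borel" and Q: "prob_space Q" "sets Q = sets borel"
    and c: "0 \<le> c" "\<And>A. A \<in> sets borel \<Longrightarrow> \<bar>measure P A - measure Q A\<bar> \<le> c * measure \<mu> A"
  shows "W1 P Q \<le> ennreal c * (\<integral>\<^sup>+u. ennreal (norm u) \<partial>\<mu>)"
proof -
  let ?N = "\<integral>\<^sup>+u. ennreal (norm u) \<partial>\<mu>"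
  have fin: "?N < \<infinity>" and \<mu>': "prob_space \<mu>" "sets \<mu> = sets borel" using \<mu> by (auto simp: P1_def)
  have bound: "W1 P Q \<le> ennreal \<epsilon> + ennreal c * (?N + ennreal \<epsilon>)" if \<epsilon>: "0 < \<epsilon>" for \<epsilon> :: real
  proof -
    obtain T :: "'x \<Rightarrow> nat" and s where T: "T \<in> borel \<rightarrow>\<^sub>M count_space UNIV" "\<And>u v. T u = T v \<Longrightarrow> dist u v \<le> \<epsilon>"
      "\<And>u. norm u \<le> s (T u)" "\<And>i. 0 \<le> s i" "\<And>u. s (T u) \<le> norm u + \<epsilon>"
      using ex_small_cells[OF \<epsilon>] by metis
    have [measurable]: "T -` {i} \<in> sets borel" for i
      using measurable_sets[OF T(1), of "{i}"] by simp
    have "W1 P Q \<le> ennreal \<epsilon> + (\<Sum>i. ennreal (\<bar>measure P (T -` {i}) - measure Q (T -` {i})\<bar> * s i))"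
      using \<epsilon> by (intro W1_le_cells P Q T(1-4)) auto
    also have "(\<Sum>i. ennreal (\<bar>measure P (T -` {i}) - measure Q (T -` {i})\<bar> * s i))
        \<le> (\<Sum>i. ennreal c * ennreal (measure \<mu> (T -` {i}) * s i))"
    proof (rule suminf_le)
      fix i
      have "\<bar>measure P (T -` {i}) - measure Q (T -` {i})\<bar> * s i \<le> c * measure \<mu> (T -` {i}) * s i"
        by (intro mult_right_mono c(2) T(4)) auto
      then show "ennreal (\<bar>measure P (T -` {i}) - measure Q (T -` {i})\<bar> * s i)
          \<le> ennreal c * ennreal (measure \<mu> (T -` {i}) * s i)"
        using c(1) T(4) by (subst ennreal_mult[symmetric]) (auto intro!: ennreal_leI simp: mult.assoc)
    qed auto
    also have "\<dots> = ennreal c * (\<Sum>i. ennreal (measure \<mu> (T -` {i}) * s i))" by simp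
    also have "\<dots> \<le> ennreal c * (?N + ennreal \<epsilon>)"
      using cells_radius_le[OF \<mu>' T(1,5,4)] \<epsilon> by (intro mult_left_mono) auto
    finally show ?thesis by (simp add: add_left_mono)
  qed
  obtain N where N: "?N = ennreal N" "0 \<le> N"
    using fin by (cases "?N") (auto simp: top_unique)
  show ?thesis
  proof (rule ennreal_le_epsilon)
    fix e :: real assume e: "0 < e"
    \<comment> \<open>The two errors \<open>\<epsilon>\<close> and \<open>c * \<epsilon>\<close> add
      up to \<open>e\<close>.\<close>
    define \<epsilon> where "\<epsilon> = e / (1 + c)"
    have \<epsilon>: "0 < \<epsilon>" "\<epsilon> * (1 + c) = e" using e c(1) by (simp_all add: \<epsilon>_def)
    have "W1 P Q \<le> ennreal (\<epsilon> + c * (N + \<epsilon>))"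
      using bound[OF \<epsilon>(1)] \<epsilon> c(1) N by (simp add: ennreal_mult ennreal_plus)
    also have "\<epsilon> + c * (N + \<epsilon>) = c * N + e"
      unfolding \<epsilon>(2)[symmetric] by (simp add: algebra_simps)
    finally show "W1 P Q \<le> ennreal c * ?N + ennreal e"
      using N c(1) e by (simp add: ennreal_mult ennreal_plus)
  qed
qed

subsection \<open>Uniqueness of limits\<close>

text \<open>
  Uniqueness of limits is obtained from Markov's inequality applied to couplings rather than from the
  triangle inequality for \<open>W1\<close>, which would need a gluing construction.
\<close>

lemma W1_thickening:
  fixes P Q :: "'x::{metric_space, second_countable_topology} measure"
  assumes P: "sets P = sets borel" and Q: "sets Q = sets borel"
    and \<delta>: "0 < \<delta>" and C: "C \<in> sets borel" and \<eta>: "W1 P Q < \<eta>"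
  shows "emeasure P C \<le> emeasure Q (\<Union>c\<in>C. ball c \<delta>) + ennreal (1 / \<delta>) * \<eta>"
    and "emeasure Q C \<le> emeasure P (\<Union>c\<in>C. ball c \<delta>) + ennreal (1 / \<delta>) * \<eta>"
proof -
  have *: "emeasure P C \<le> emeasure Q (\<Union>c\<in>C. ball c \<delta>) + ennreal (1 / \<delta>) * (\<integral>\<^sup>+p. ennreal (dist (fst p) (snd p)) \<partial>\<pi>)
      \<and> emeasure Q C \<le> emeasure P (\<Union>c\<in>C. ball c \<delta>) + ennreal (1 / \<delta>) * (\<integral>\<^sup>+p. ennreal (dist (fst p) (snd p)) \<partial>\<pi>)"
    if \<pi>: "\<pi> \<in> couplings P Q" for \<pi>
  proof -
    have s\<pi> [measurable_cong]: "sets \<pi> = sets (borel \<Otimes>\<^sub>M borel)" and m: "distr \<pi> borel fst = P" "distr \<pi> borel snd = Q"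
      using \<pi> by (auto simp: couplings_def)
    have sp: "space \<pi> = UNIV" using sets_eq_imp_space_eq[OF s\<pi>] by (simp add: space_pair_measure)
    have [measurable]: "fst \<in> borel_measurable \<pi>" "snd \<in> borel_measurable \<pi>"
      by measurable
    have [measurable]: "C \<in> sets borel" "(\<Union>c\<in>C. ball c \<delta>) \<in> sets borel"
      using C by (auto intro!: borel_open)
    have eP: "emeasure P A = emeasure \<pi> (fst -` A)" and eQ: "emeasure Q A = emeasure \<pi> (snd -` A)"
      if "A \<in> sets borel" for A
      using that unfolding m[symmetric] by (simp_all add: emeasure_distr sp)
    have meas [measurable]: "fst -` A \<in> sets \<pi>" "snd -` A \<in> sets \<pi>" if "A \<in> sets borel" for A :: "'x set"
      using measurable_sets[of fst \<pi> borel A] measurable_sets[of snd \<pi> borel A] that by (auto simp: sp)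
    \<comment> \<open>\<open>?F\<close> holds the pairs at distance at least
      \<open>\<delta>\<close>. Outside it, one point in \<open>C\<close> forces the other into the
      open thickening of \<open>C\<close>, and Markov's inequality bounds \<open>?F\<close> by the
      transport cost.\<close>
    let ?F = "{p. 1 \<le> ennreal (1 / \<delta>) * ennreal (dist (fst p) (snd p))}"
    have F [measurable]: "?F \<in> sets \<pi>"
    proof -
      have "{p\<in>space \<pi>. 1 \<le> ennreal (1 / \<delta>) * ennreal (dist (fst p) (snd p))} \<in> sets \<pi>" by measurable
      then show ?thesis by (simp add: sp)
    qed
    have Fle: "emeasure \<pi> ?F \<le> ennreal (1 / \<delta>) * (\<integral>\<^sup>+p. ennreal (dist (fst p) (snd p)) \<partial>\<pi>)"
      using nn_integral_Markov_inequality[of "\<lambda>p. ennreal (dist (fst p) (snd p))" UNIV \<pi> "ennreal (1 / \<delta>)"] sp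
        sets.top[of \<pi>] by simp
    have inF: "p \<in> ?F" if "\<delta> \<le> dist (fst p) (snd p)" for p :: "'x \<times> 'x"
      using that \<delta> by (simp add: ennreal_mult[symmetric] ennreal_1[symmetric] del: ennreal_1)
    have "fst -` C \<subseteq> snd -` (\<Union>c\<in>C. ball c \<delta>) \<union> ?F"
      using inF by (fastforce simp: not_le)
    then have "emeasure \<pi> (fst -` C) \<le> emeasure \<pi> (snd -` (\<Union>c\<in>C. ball c \<delta>)) + emeasure \<pi> ?F"
      by (intro order_trans[OF emeasure_mono emeasure_subadditive]) auto
    moreover have "snd -` C \<subseteq> fst -` (\<Union>c\<in>C. ball c \<delta>) \<union> ?F"
      using inF by (fastforce simp: not_le dist_commute)
    then have "emeasure \<pi> (snd -` C) \<le> emeasure \<pi> (fst -` (\<Union>c\<in>C. ball c \<delta>)) + emeasure \<pi> ?F"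
      by (intro order_trans[OF emeasure_mono emeasure_subadditive]) auto
    ultimately show ?thesis
      using Fle by (auto simp: eP eQ intro: order_trans[OF _ add_left_mono])
  qed
  \<comment> \<open>Attainment of the infimum is left open; the strict bound supplies a coupling of
    cost below \<open>\<eta>\<close>.\<close>
  obtain \<pi> where "\<pi> \<in> couplings P Q" and lt: "(\<integral>\<^sup>+p. ennreal (dist (fst p) (snd p)) \<partial>\<pi>) < \<eta>"
    using \<eta> unfolding W1_def INF_less_iff by auto
  from *[OF this(1)] mult_left_mono[OF less_imp_le[OF lt], of "ennreal (1 / \<delta>)"]
  show "emeasure P C \<le> emeasure Q (\<Union>c\<in>C. ball c \<delta>) + ennreal (1 / \<delta>) * \<eta>"
    "emeasure Q C \<le> emeasure P (\<Union>c\<in>C. ball c \<delta>) + ennreal (1 / \<delta>) * \<eta>"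
    by (auto intro: order_trans[OF _ add_left_mono])
qed

text \<open>Passing from one limit to \<open>P k\<close> and on to the other thickens
  \<open>C\<close> twice. Closedness enters because the thickenings then shrink to \<open>C\<close>
  itself.\<close>

lemma W1_limit_closed_le:
  fixes \<mu> \<nu> :: "'x::{metric_space, second_countable_topology} measure"
  assumes \<mu>: "sets \<mu> = sets borel" and \<nu>: "prob_space \<nu>" "sets \<nu> = sets borel"
    and P: "\<And>k. sets (P k) = sets borel"
    and lim: "(\<lambda>k. W1 (P k) \<mu>) \<longlonglongrightarrow> 0" "(\<lambda>k. W1 (P k) \<nu>) \<longlonglongrightarrow> 0"
    and C: "closed C"
  shows "emeasure \<mu> C \<le> emeasure \<nu> C"
proof -
  interpret \<nu>: prob_space \<nu> by fact
  define U where "U d = (\<Union>c\<in>C. ball c d)" for d :: real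
  have U [measurable]: "U d \<in> sets borel" for d unfolding U_def by (auto intro!: borel_open)
  have Cb [measurable]: "C \<in> sets borel" using C by (rule borel_closed)
  have le: "emeasure \<mu> C \<le> emeasure \<nu> (U (2 * d)) + ennreal (2 * d)" if d: "0 < d" for d
  proof -
    \<comment> \<open>The threshold \<open>d * d\<close> compensates the Markov factor
      \<open>1 / d\<close>, so each of the two passages costs \<open>d\<close>.\<close>
    have d2: "0 < ennreal (d * d)" using d by simp
    have "\<forall>\<^sub>F k in sequentially. W1 (P k) \<mu> < ennreal (d * d) \<and> W1 (P k) \<nu> < ennreal (d * d)"
      by (intro eventually_conj order_tendstoD(2)[OF lim(1) d2] order_tendstoD(2)[OF lim(2) d2])
    then obtain k where k: "W1 (P k) \<mu> < ennreal (d * d)" "W1 (P k) \<nu> < ennreal (d * d)"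
      using eventually_happens'[OF sequentially_bot] by blast
    have dd: "ennreal (1 / d) * ennreal (d * d) = ennreal d"
      using d by (simp add: ennreal_mult[symmetric])
    have UU: "(\<Union>c\<in>U d. ball c d) \<subseteq> U (2 * d)"
    proof
      fix x assume "x \<in> (\<Union>c\<in>U d. ball c d)"
      then obtain c c' where "c \<in> C" "dist c c' < d" "dist c' x < d" by (auto simp: U_def)
      then show "x \<in> U (2 * d)" using dist_triangle[of c x c'] by (auto simp: U_def intro!: bexI[of _ c])
    qed
    have "emeasure \<mu> C \<le> emeasure (P k) (U d) + ennreal d"
      using W1_thickening(2)[OF P \<mu> d Cb k(1)] by (simp add: dd U_def)
    also have "emeasure (P k) (U d) \<le> emeasure \<nu> (\<Union>c\<in>U d. ball c d) + ennreal d"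
      using W1_thickening(1)[OF P \<nu>(2) d U k(2)] by (simp add: dd)
    also have "emeasure \<nu> (\<Union>c\<in>U d. ball c d) \<le> emeasure \<nu> (U (2 * d))"
      using UU by (intro emeasure_mono) (auto simp: \<nu>(2))
    finally show ?thesis using d
      by (simp add: add_mono add.assoc ennreal_plus[symmetric] del: ennreal_plus)
  qed
  define \<delta> where "\<delta> n = inverse (real (Suc n))" for n
  have \<delta>: "0 < \<delta> n" for n by (simp add: \<delta>_def)
  have \<delta>0: "\<delta> \<longlonglongrightarrow> 0" unfolding \<delta>_def by (rule LIMSEQ_inverse_real_of_nat)
  have "(\<lambda>n. emeasure \<nu> (U (2 * \<delta> n))) \<longlonglongrightarrow> emeasure \<nu> (\<Inter>n. U (2 * \<delta> n))"
  proof (rule Lim_emeasure_decseq)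
    show "decseq (\<lambda>n. U (2 * \<delta> n))"
    proof (rule decseq_SucI)
      fix n
      have "\<delta> (Suc n) \<le> \<delta> n" unfolding \<delta>_def by (intro le_imp_inverse_le) auto
      then show "U (2 * \<delta> (Suc n)) \<subseteq> U (2 * \<delta> n)"
        unfolding U_def by (intro UN_mono subset_refl subset_ball) simp
    qed
  qed (auto simp: \<nu>(2))
  also have "(\<Inter>n. U (2 * \<delta> n)) = C"
  proof (intro equalityI subsetI)
    fix x assume x: "x \<in> (\<Inter>n. U (2 * \<delta> n))"
    have "x \<in> closure C"
      unfolding closure_approachable
    proof (intro allI impI)
      fix e :: real assume "0 < e"
      then have "\<forall>\<^sub>F n in sequentially. 2 * \<delta> n < e"
        using tendsto_mult_right_zero[OF \<delta>0, of 2] by (intro order_tendstoD) auto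
      then obtain n where "2 * \<delta> n < e" using eventually_happens'[OF sequentially_bot] by blast
      moreover have "x \<in> U (2 * \<delta> n)" using x by blast
      then obtain y where "y \<in> C" "dist y x < 2 * \<delta> n" by (auto simp: U_def)
      ultimately show "\<exists>y\<in>C. dist y x < e" by (intro bexI[of _ y]) auto
    qed
    then show "x \<in> C" using C by simp
  qed (use \<delta> in \<open>auto simp: U_def intro!: bexI\<close>)
  finally have "(\<lambda>n. emeasure \<nu> (U (2 * \<delta> n)) + ennreal (2 * \<delta> n)) \<longlonglongrightarrow> emeasure \<nu> C + ennreal 0"
    using tendsto_mult_right_zero[OF \<delta>0, of 2] by (intro tendsto_add tendsto_ennrealI)
  then show ?thesis
    using le[OF \<delta>] by (intro LIMSEQ_le_const) auto
qed

lemma W1_limit_unique: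
  fixes \<mu> \<nu> :: "'x::{metric_space, second_countable_topology} measure"
  assumes \<mu>: "prob_space \<mu>" "sets \<mu> = sets borel" and \<nu>: "prob_space \<nu>" "sets \<nu> = sets borel"
    and P: "\<And>k. sets (P k) = sets borel"
    and lim: "(\<lambda>k. W1 (P k) \<mu>) \<longlonglongrightarrow> 0" "(\<lambda>k. W1 (P k) \<nu>) \<longlonglongrightarrow> 0"
  shows "\<mu> = \<nu>"
proof (rule measure_eqI_generator_eq[where E = "Collect closed" and \<Omega> = UNIV and A = "\<lambda>_. UNIV"])
  interpret \<mu>: prob_space \<mu> by fact
  show "emeasure \<mu> C = emeasure \<nu> C" if "C \<in> Collect closed" for C
    using that W1_limit_closed_le[OF \<mu>(2) \<nu> P lim] W1_limit_closed_le[OF \<nu>(2) \<mu> P lim(2,1)]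
    by (intro antisym) auto
  show "sets \<mu> = sigma_sets UNIV (Collect closed)" "sets \<nu> = sigma_sets UNIV (Collect closed)"
    unfolding \<mu> \<nu> borel_eq_closed by simp_all
  show "emeasure \<mu> UNIV \<noteq> \<infinity>"
    using \<mu>.emeasure_finite[of UNIV] by simp
qed (auto simp: Int_stable_def)

subsection \<open>Setwise convergence implies uniform Wasserstein convergence\<close>

text \<open>Domination provides the summable majorant \<open>2 * b * w i\<close> for passing to the
  limit under the sum over cells at a fixed \<open>y\<close>. The Lipschitz bound then carries
  smallness from a finite net to all of \<open>S\<close>.\<close>

lemma W1_tendsto_uniformly_on_compact:
  fixes \<mu> :: "'x::{real_normed_vector, second_countable_topology} measure"
    and P :: "nat \<Rightarrow> 'y::metric_space \<Rightarrow> 'x measure"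
  assumes \<mu>: "P1 \<mu>"
    and P: "\<And>k y. prob_space (P k y)" "\<And>k y. sets (P k y) = sets borel"
    and Q: "\<And>y. prob_space (Q y)" "\<And>y. sets (Q y) = sets borel"
    and S: "compact S"
    and dom: "\<And>k y A. y \<in> S \<Longrightarrow> A \<in> sets borel \<Longrightarrow> measure (P k y) A \<le> b * measure \<mu> A"
    and lip: "\<And>k y y' A. y \<in> S \<Longrightarrow> y' \<in> S \<Longrightarrow> A \<in> sets borel \<Longrightarrow>
      \<bar>measure (P k y) A - measure (P k y') A\<bar> \<le> c * dist y y' * measure \<mu> A"
    and conv: "\<And>y A. y \<in> S \<Longrightarrow> A \<in> sets borel \<Longrightarrow> (\<lambda>k. measure (P k y) A) \<longlonglongrightarrow> measure (Q y) A"
  shows "(\<lambda>k. SUP y\<in>S. W1 (P k y) (Q y)) \<longlonglongrightarrow> 0"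
proof (rule tendsto_zero_ennreal)
  fix e :: real assume e: "0 < e"
  \<comment> \<open>The final bound is \<open>3 * \<epsilon>\<close>: one for the cell size, one for
    the value at a net point, one for moving from the net point to \<open>y\<close>.\<close>
  define \<epsilon> where "\<epsilon> = e / 8"
  have \<epsilon>: "0 < \<epsilon>" using e by (simp add: \<epsilon>_def)
  have \<mu>': "prob_space \<mu>" "sets \<mu> = sets borel" and fin: "(\<integral>\<^sup>+u. ennreal (norm u) \<partial>\<mu>) < \<infinity>"
    using \<mu> by (auto simp: P1_def)
  obtain T :: "'x \<Rightarrow> nat" and s where T: "T \<in> borel \<rightarrow>\<^sub>M count_space UNIV" "\<And>u v. T u = T v \<Longrightarrow> dist u v \<le> \<epsilon>"
    "\<And>u. norm u \<le> s (T u)" "\<And>i. 0 \<le> s i" "\<And>u. s (T u) \<le> norm u + \<epsilon>"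
    using ex_small_cells[OF \<epsilon>] by metis
  let ?A = "\<lambda>i. T -` {i}"
  have A: "?A i \<in> sets borel" for i using measurable_sets[OF T(1), of "{i}"] by simp
  define w where "w i = measure \<mu> (?A i) * s i" for i
  have w0: "0 \<le> w i" for i using T(4) by (simp add: w_def)
  have "(\<Sum>i. ennreal (w i)) \<noteq> \<top>"
    using cells_radius_le[OF \<mu>' T(1,5,4)] \<epsilon> fin by (auto simp: w_def top_unique)
  then have w: "summable w"
    using summable_suminf_not_top[of w] w0 by auto
  define G where "G k y = (\<Sum>i. \<bar>measure (P k y) (?A i) - measure (Q y) (?A i)\<bar> * s i)" for k y
  have domQ: "measure (Q y) B \<le> b * measure \<mu> B" if "y \<in> S" "B \<in> sets borel" for y B
    using conv[OF that] by (rule LIMSEQ_le_const2) (auto intro: dom[OF that])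
  have lipQ: "\<bar>measure (Q y) B - measure (Q y') B\<bar> \<le> c * dist y y' * measure \<mu> B"
    if "y \<in> S" "y' \<in> S" "B \<in> sets borel" for y y' B
    using tendsto_rabs[OF tendsto_diff[OF conv[OF that(1,3)] conv[OF that(2,3)]]]
    by (rule LIMSEQ_le_const2) (auto intro: lip[OF that])
  have term_le: "\<bar>measure (P k y) (?A i) - measure (Q y) (?A i)\<bar> * s i \<le> 2 * b * w i"
    if y: "y \<in> S" for k y i
  proof -
    have "\<bar>measure (P k y) (?A i) - measure (Q y) (?A i)\<bar> \<le> measure (P k y) (?A i) + measure (Q y) (?A i)"
      using measure_nonneg[of "P k y" "?A i"] measure_nonneg[of "Q y" "?A i"] by linarith
    also have "\<dots> \<le> 2 * b * measure \<mu> (?A i)"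
      using dom[OF y A, of k i] domQ[OF y A, of i] by simp
    finally show ?thesis
      using mult_right_mono[OF _ T(4)] by (fastforce simp: w_def mult.assoc)
  qed
  have sumG: "summable (\<lambda>i. \<bar>measure (P k y) (?A i) - measure (Q y) (?A i)\<bar> * s i)" if "y \<in> S" for k y
    by (rule summable_comparison_test[OF _ summable_mult[OF w, of "2 * b"]])
       (use term_le[OF that] T(4) in \<open>auto intro!: exI[of _ 0]\<close>)
  have W1G: "W1 (P k y) (Q y) \<le> ennreal (\<epsilon> + G k y)" if "y \<in> S" for k y
  proof -
    have "W1 (P k y) (Q y) \<le> ennreal \<epsilon> + (\<Sum>i. ennreal (\<bar>measure (P k y) (?A i) - measure (Q y) (?A i)\<bar> * s i))"
      using \<epsilon> by (intro W1_le_cells P Q T(1-4)) auto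
    also have "\<dots> = ennreal \<epsilon> + ennreal (G k y)"
      unfolding G_def using T(4) by (subst suminf_ennreal2[OF _ sumG[OF that]]) auto
    also have "\<dots> = ennreal (\<epsilon> + G k y)"
      using \<epsilon> T(4) by (intro ennreal_plus[symmetric]) (auto simp: G_def intro!: suminf_nonneg sumG[OF that])
    finally show ?thesis .
  qed
  have G0: "(\<lambda>k. G k y) \<longlonglongrightarrow> 0" if y: "y \<in> S" for y
  proof -
    have "(\<lambda>k. \<Sum>i. \<bar>measure (P k y) (?A i) - measure (Q y) (?A i)\<bar> * s i) \<longlonglongrightarrow> (\<Sum>i::nat. 0)"
    proof (rule tannerys_theorem[THEN conjunct2, THEN conjunct2])
      show "(\<lambda>k. \<bar>measure (P k y) (?A i) - measure (Q y) (?A i)\<bar> * s i) \<longlonglongrightarrow> 0" for i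
        using conv[OF y A, of i] by (intro tendsto_mult_left_zero tendsto_rabs_zero) (simp add: LIM_zero)
      show "\<forall>\<^sub>F (i, k) in sequentially \<times>\<^sub>F sequentially.
          norm (\<bar>measure (P k y) (?A i) - measure (Q y) (?A i)\<bar> * s i) \<le> 2 * b * w i"
        using term_le[OF y] T(4) by (intro always_eventually) auto
    qed (use w in auto)
    then show ?thesis by (simp add: G_def)
  qed
  \<comment> \<open>The factor 2 counts the Lipschitz bounds of \<open>P k\<close> and of its limit
    \<open>Q\<close>.\<close>
  have Glip: "G k y \<le> G k y' + 2 * c * dist y y' * suminf w" if y: "y \<in> S" "y' \<in> S" for k y y'
  proof -
    have "G k y \<le> (\<Sum>i. \<bar>measure (P k y') (?A i) - measure (Q y') (?A i)\<bar> * s i + 2 * c * dist y y' * w i)"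
      unfolding G_def
    proof (rule suminf_le[OF _ sumG[OF y(1)] summable_add[OF sumG[OF y(2)] summable_mult[OF w]]])
      fix i
      have "\<bar>measure (P k y) (?A i) - measure (Q y) (?A i)\<bar> \<le>
          \<bar>measure (P k y') (?A i) - measure (Q y') (?A i)\<bar> + 2 * c * dist y y' * measure \<mu> (?A i)"
        using lip[OF y A, of k i] lipQ[OF y A, of i] by linarith
      from mult_right_mono[OF this T(4)[of i]]
      show "\<bar>measure (P k y) (?A i) - measure (Q y) (?A i)\<bar> * s i \<le>
          \<bar>measure (P k y') (?A i) - measure (Q y') (?A i)\<bar> * s i + 2 * c * dist y y' * w i"
        by (simp add: w_def algebra_simps)
    qed
    also have "\<dots> = G k y' + 2 * c * dist y y' * suminf w"
      unfolding G_def using w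
      by (subst suminf_add[symmetric]) (auto intro!: sumG[OF y(2)] summable_mult simp: suminf_mult)
    finally show ?thesis .
  qed
  \<comment> \<open>The absolute value covers a negative \<open>c\<close>, and the summand 1 keeps
    the denominator positive.\<close>
  define \<delta> where "\<delta> = \<epsilon> / (2 * \<bar>c\<bar> * suminf w + 1)"
  have W0: "0 \<le> suminf w" using w w0 by (intro suminf_nonneg)
  have \<delta>: "0 < \<delta>" using \<epsilon> W0 by (auto simp: \<delta>_def intro!: divide_pos_pos add_nonneg_pos)
  have \<delta>le: "2 * c * d * suminf w \<le> \<epsilon>" if "0 \<le> d" "d \<le> \<delta>" for d
  proof -
    have "2 * c * d * suminf w = (2 * c * suminf w) * d" by simp
    also have "\<dots> \<le> (2 * \<bar>c\<bar> * suminf w + 1) * \<delta>"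
      using that W0 mult_right_mono[OF abs_ge_self[of c] W0] by (intro mult_mono) auto
    also have "\<dots> = \<epsilon>"
      using W0 by (simp add: \<delta>_def add_nonneg_eq_0_iff)
    finally show ?thesis .
  qed
  have "S \<subseteq> (\<Union>y\<in>S. ball y \<delta>)" using \<delta> by force
  then obtain F where F: "F \<subseteq> S" "finite F" "S \<subseteq> (\<Union>y\<in>F. ball y \<delta>)"
    by (rule compactE_image[OF S open_ball])
  have "\<forall>\<^sub>F k in sequentially. \<forall>y\<in>F. G k y < \<epsilon>"
    using F \<epsilon> by (intro eventually_ball_finite ballI order_tendstoD(2)[OF G0]) auto
  then show "\<forall>\<^sub>F k in sequentially. (SUP y\<in>S. W1 (P k y) (Q y)) < ennreal e"
  proof eventually_elim
    case (elim k)
    have "W1 (P k y) (Q y) \<le> ennreal (3 * \<epsilon>)" if y: "y \<in> S" for y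
    proof -
      obtain y' where y': "y' \<in> F" "dist y' y < \<delta>" using F(3) y by auto
      have "G k y \<le> G k y' + 2 * c * dist y y' * suminf w"
        using y' F(1) y by (intro Glip) auto
      also have "\<dots> \<le> \<epsilon> + \<epsilon>"
        using elim y' by (intro add_mono \<delta>le) (auto simp: dist_commute less_imp_le)
      finally show ?thesis
        by (intro order_trans[OF W1G[OF y]] ennreal_leI) simp
    qed
    then have "(SUP y\<in>S. W1 (P k y) (Q y)) \<le> ennreal (3 * \<epsilon>)" by (rule SUP_least)
    also have "\<dots> < ennreal e" using e by (simp add: \<epsilon>_def ennreal_less_iff)
    finally show ?case .
  qed
qed

subsection \<open>Compactness for setwise convergence\<close>

text \<open>Convergent sequences are closed under uniform limits. This carries convergence from
  countably many test pairs of a point and a set to all pairs.\<close>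

lemma convergent_if_uniformly_approximated:
  fixes f :: "nat \<Rightarrow> 'a::banach"
  assumes "\<And>e. 0 < e \<Longrightarrow> \<exists>g. convergent g \<and> (\<forall>k. dist (f k) (g k) \<le> e)"
  shows "convergent f"
proof -
  have "Cauchy f"
  proof (rule metric_CauchyI)
    fix e :: real assume e: "0 < e"
    then obtain g where g: "convergent g" "\<And>k. dist (f k) (g k) \<le> e / 4"
      using assms[of "e / 4"] by auto
    obtain N where N: "\<And>m n. N \<le> m \<Longrightarrow> N \<le> n \<Longrightarrow> dist (g m) (g n) < e / 4"
      using metric_CauchyD[OF convergent_Cauchy[OF g(1)], of "e / 4"] e by auto
    have "dist (f m) (f n) < e" if "N \<le> m" "N \<le> n" for m n
    proof -
      have "dist (f m) (f n) \<le> dist (f m) (g m) + (dist (g m) (g n) + dist (g n) (f n))"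
        by (meson add_left_mono dist_triangle order_trans)
      then show ?thesis using g(2)[of m] g(2)[of n] N[OF that] e by (simp add: dist_commute)
    qed
    then show "\<exists>M. \<forall>m\<ge>M. \<forall>n\<ge>M. dist (f m) (f n) < e" by blast
  qed
  then show ?thesis by (rule Cauchy_convergent)
qed

text \<open>Outer regularity puts \<open>A\<close> into an open set of almost the same measure, and
  that open set is exhausted by finite unions of basic sets. These unions form a countable family
  fixed before \<open>A\<close>, as a diagonal argument requires.\<close>

lemma borel_approx_finite_union:
  fixes \<mu> :: "'x::{second_countable_topology, complete_space} measure"
  assumes "finite_measure \<mu>" and s\<mu>: "sets \<mu> = sets borel" and B: "topological_basis B" "countable B"
    and A: "A \<in> sets borel" and e: "0 < e"
  shows "\<exists>S. finite S \<and> S \<subseteq> B \<and> measure \<mu> ((A - \<Union>S) \<union> (\<Union>S - A)) \<le> e"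
proof -
  interpret finite_measure \<mu> by fact
  have "\<exists>U\<in>{U. A \<subseteq> U \<and> open U}. emeasure \<mu> U < emeasure \<mu> A + ennreal (e / 2)"
  proof (rule INF_approx_ennreal)
    show "emeasure \<mu> A = (INF U\<in>{U. A \<subseteq> U \<and> open U}. emeasure \<mu> U)"
      using emeasure_finite by (intro outer_regular s\<mu> A) (simp add: top_unique[symmetric])
  qed (use e emeasure_finite in auto)
  then obtain U where U: "A \<subseteq> U" "open U" and "emeasure \<mu> U < emeasure \<mu> A + ennreal (e / 2)"
    by auto
  then have U': "measure \<mu> U < measure \<mu> A + e / 2"
    using e by (simp add: emeasure_eq_measure ennreal_plus[symmetric] ennreal_less_iff del: ennreal_plus)
  obtain B' where B': "B' \<subseteq> B" "\<Union>B' = U"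
    using B(1) U(2) by (auto simp: topological_basis_def)
  have cB': "countable B'" using B' B(2) by (auto intro: countable_subset)
  have opB: "open X" if "X \<in> B" for X using topological_basis_open[OF B(1) that] .
  \<comment> \<open>The intersection with \<open>B'\<close> discards the arbitrary value of
    \<open>from_nat_into\<close> when \<open>B'\<close> is empty.\<close>
  define V where "V n = \<Union>(from_nat_into B' ` {..<n} \<inter> B')" for n
  have Vm: "V n \<in> sets \<mu>" for n
    using B'(1) opB unfolding s\<mu> V_def by (intro borel_open open_Union) auto
  have "(\<lambda>n. measure \<mu> (V n)) \<longlonglongrightarrow> measure \<mu> (\<Union>n. V n)"
  proof (rule finite_Lim_measure_incseq)
    show "incseq V"
      unfolding V_def by (intro incseq_SucI Union_mono Int_mono image_mono subset_refl) auto
  qed (use Vm in auto)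
  also have "(\<Union>n. V n) = U"
  proof (intro equalityI subsetI)
    fix x assume "x \<in> U"
    then obtain X where X: "X \<in> B'" "x \<in> X" using B' by auto
    then obtain n where "from_nat_into B' n = X" using from_nat_into_surj[OF cB' X(1)] by auto
    then have "x \<in> V (Suc n)" using X by (auto simp: V_def intro!: bexI[of _ n])
    then show "x \<in> (\<Union>n. V n)" by blast
  qed (use B' in \<open>auto simp: V_def\<close>)
  finally have "\<forall>\<^sub>F n in sequentially. measure \<mu> U - e / 2 < measure \<mu> (V n)"
    using e by (intro order_tendstoD) auto
  then obtain n where n: "measure \<mu> U - e / 2 < measure \<mu> (V n)"
    using eventually_happens'[OF sequentially_bot] by blast
  have VU: "V n \<subseteq> U" using B' by (auto simp: V_def)
  have Um: "U \<in> sets \<mu>" and Am: "A \<in> sets \<mu>" using U(2) A by (auto simp: s\<mu>)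
  have "measure \<mu> ((A - V n) \<union> (V n - A)) \<le> measure \<mu> ((U - V n) \<union> (U - A))"
    using VU U(1) Um Am Vm by (intro finite_measure_mono) auto
  also have "\<dots> \<le> measure \<mu> (U - V n) + measure \<mu> (U - A)"
    using Um Am Vm by (intro measure_Un_le) auto
  also have "\<dots> = (measure \<mu> U - measure \<mu> (V n)) + (measure \<mu> U - measure \<mu> A)"
    using Um Am Vm VU U(1) by (simp add: finite_measure_Diff)
  also have "\<dots> \<le> e" using n U' by simp
  finally show ?thesis
    using B'(1) unfolding V_def by (intro exI[of _ "from_nat_into B' ` {..<n} \<inter> B'"]) auto
qed

text \<open>Finite additivity passes to the limit of the masses. Domination by \<open>b\<close>
  times the finite measure \<open>\<mu>\<close> gives continuity at the empty set, which upgrades it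
  to countable additivity.\<close>

lemma setwise_limit_is_measure:
  fixes \<mu> :: "'x::topological_space measure"
  assumes "finite_measure \<mu>" and s\<mu>: "sets \<mu> = sets borel"
    and P: "\<And>k. prob_space (P k)" "\<And>k. sets (P k) = sets borel"
    and dom: "\<And>k A. A \<in> sets borel \<Longrightarrow> measure (P k) A \<le> b * measure \<mu> A"
    and conv: "\<And>A. A \<in> sets borel \<Longrightarrow> convergent (\<lambda>k. measure (P k) A)"
  shows "\<exists>Q. prob_space Q \<and> sets Q = sets borel \<and>
    (\<forall>A\<in>sets borel. (\<lambda>k. measure (P k) A) \<longlonglongrightarrow> measure Q A)"
proof -
  interpret finite_measure \<mu> by fact
  interpret P: prob_space "P k" for k by (rule P)
  define q where "q A = lim (\<lambda>k. measure (P k) A)" for A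
  have q: "(\<lambda>k. measure (P k) A) \<longlonglongrightarrow> q A" if "A \<in> sets borel" for A
    using conv[OF that] unfolding q_def convergent_LIMSEQ_iff .
  have q0: "0 \<le> q A" if "A \<in> sets borel" for A
    using q[OF that] by (rule LIMSEQ_le_const) auto
  have qle: "q A \<le> b * measure \<mu> A" if "A \<in> sets borel" for A
    using q[OF that] by (rule LIMSEQ_le_const2) (auto intro: dom[OF that])
  have qadd: "q (A \<union> A') = q A + q A'" if "A \<in> sets borel" "A' \<in> sets borel" "A \<inter> A' = {}" for A A'
  proof -
    have "(\<lambda>k. measure (P k) (A \<union> A')) \<longlonglongrightarrow> q A + q A'"
      using tendsto_add[OF q[OF that(1)] q[OF that(2)]] that
      by (simp add: P.finite_measure_Union P(2))
    moreover have "A \<union> A' \<in> sets borel" using that by simp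
    ultimately show ?thesis using q LIMSEQ_unique by metis
  qed
  define Q where "Q = measure_of UNIV (sets borel) (\<lambda>A. ennreal (q A))"
  have sQ: "sets Q = sets (borel :: 'x measure)"
    using sets.sigma_sets_eq[of "borel :: 'x measure"] by (simp add: Q_def)
  have eQ: "emeasure Q A = ennreal (q A)" if A: "A \<in> sets borel" for A
  proof (rule emeasure_measure_of[OF Q_def])
    have ring: "ring_of_sets UNIV (sets (borel :: 'x measure))"
      using sets.ring_of_sets_axioms[of "borel :: 'x measure"] by simp
    have q_empty: "q {} = 0"
      using qadd[of "{}" "{}"] by simp
    have pos: "positive (sets borel) (\<lambda>A. ennreal (q A))"
      by (simp add: positive_def q_empty)
    have "countably_additive (sets borel) (\<lambda>A. ennreal (q A))"
    proof (rule ring_of_sets.empty_continuous_imp_countably_additive[OF ring pos])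
      show "additive (sets borel) (\<lambda>A. ennreal (q A))"
        by (auto simp: additive_def qadd q0)
    next
      fix X :: "nat \<Rightarrow> 'x set" assume X: "range X \<subseteq> sets borel" "decseq X" "(\<Inter>i. X i) = {}"
      have Xm: "X i \<in> sets borel" for i using X(1) by auto
      have "(\<lambda>i. measure \<mu> (X i)) \<longlonglongrightarrow> 0"
        using finite_Lim_measure_decseq[of X] X by (simp add: s\<mu>)
      then have lim: "(\<lambda>i. b * measure \<mu> (X i)) \<longlonglongrightarrow> 0"
        by (rule tendsto_mult_right_zero)
      have "(\<lambda>i. q (X i)) \<longlonglongrightarrow> 0"
        by (rule tendsto_sandwich[OF _ _ tendsto_const lim]) (simp_all add: q0 qle Xm)
      from tendsto_ennrealI[OF this]
      show "(\<lambda>i. ennreal (q (X i))) \<longlonglongrightarrow> 0" by simp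
    qed auto
    then show "countably_additive (sets Q) (\<lambda>A. ennreal (q A))" by (simp add: sQ)
    show "positive (sets Q) (\<lambda>A. ennreal (q A))" using pos by (simp add: sQ)
  qed (use A sQ in auto)
  have spP: "space (P k) = UNIV" for k using sets_eq_imp_space_eq[OF P(2)[of k]] by simp
  have "q UNIV = 1"
    using q[of UNIV] P.prob_space LIMSEQ_unique[OF _ tendsto_const] by (simp add: spP)
  then have "prob_space Q"
    using sets_eq_imp_space_eq[OF sQ] by (intro prob_spaceI) (simp add: eQ)
  moreover have "measure Q A = q A" if "A \<in> sets borel" for A
    using eQ[OF that] q0[OF that] by (simp add: measure_def)
  ultimately show ?thesis using sQ q by auto
qed

text \<open>The diagonal sequence is chosen for dense \<open>y\<close> and finite unions of basic
  sets only. An arbitrary \<open>y\<close> is reached through \<open>lip\<close> and an arbitrary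
  \<open>A\<close> through \<open>dom\<close>; both errors are uniform in \<open>k\<close>, so
  convergence survives.\<close>

lemma setwise_subsequence_exists:
  fixes \<mu> :: "'x::{second_countable_topology, complete_space} measure"
    and P :: "nat \<Rightarrow> 'y::{real_normed_vector, second_countable_topology} \<Rightarrow> 'x measure"
  assumes \<mu>: "prob_space \<mu>" "sets \<mu> = sets borel"
    and P: "\<And>k y. prob_space (P k y)" "\<And>k y. sets (P k y) = sets borel"
    and dom: "\<And>R. \<exists>b. \<forall>k y A. norm y \<le> R \<longrightarrow> A \<in> sets borel \<longrightarrow> measure (P k y) A \<le> b * measure \<mu> A"
    and lip: "\<And>R. \<exists>c. \<forall>k y y' A. norm y \<le> R \<longrightarrow> norm y' \<le> R \<longrightarrow> A \<in> sets borel \<longrightarrow>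
      \<bar>measure (P k y) A - measure (P k y') A\<bar> \<le> c * dist y y' * measure \<mu> A"
  shows "\<exists>r Q. strict_mono (r :: nat \<Rightarrow> nat) \<and> (\<forall>y. prob_space (Q y) \<and> sets (Q y) = sets borel \<and>
    (\<forall>A\<in>sets borel. (\<lambda>k. measure (P (r k) y) A) \<longlonglongrightarrow> measure (Q y) A))"
proof -
  interpret prob_space \<mu> by fact
  interpret P: prob_space "P k y" for k y by (rule P)
  obtain B :: "'x set set" where B: "topological_basis B" "countable B"
    using ex_countable_basis by auto
  obtain D :: "'y set" where D: "countable D" "\<And>X. open X \<Longrightarrow> X \<noteq> {} \<Longrightarrow> \<exists>d\<in>D. d \<in> X"
    using countable_dense_setE by metis
  define I where "I = D \<times> {S. finite S \<and> S \<subseteq> B}"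
  have I: "countable I" "I \<noteq> {}"
    unfolding I_def using D(1) D(2)[of UNIV] countable_Collect_finite_subset[OF B(2)]
    by (auto intro!: countable_SIGMA)
  define p where "p n = from_nat_into I n" for n
  interpret subseqs "\<lambda>n s. convergent (\<lambda>k. measure (P (s k) (fst (p n))) (\<Union>(snd (p n))))"
  proof
    fix n and s :: "nat \<Rightarrow> nat"
    let ?f = "\<lambda>k. measure (P (s k) (fst (p n))) (\<Union>(snd (p n)))"
    have "Bseq ?f" by (rule BseqI'[of _ 1]) simp
    then have "bounded (range ?f)" by (simp add: Bseq_eq_bounded)
    then obtain l r where "strict_mono r" "(?f \<circ> r) \<longlonglongrightarrow> l"
      using bounded_imp_convergent_subsequence by blast
    then show "\<exists>r'. strict_mono r' \<and> convergent (\<lambda>k. measure (P ((s \<circ> r') k) (fst (p n))) (\<Union>(snd (p n))))"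
      by (auto simp: o_def convergent_def)
  qed
  define r where "r = diagseq"
  have r: "strict_mono r" unfolding r_def by (rule subseq_diagseq)
  have conv_I: "convergent (\<lambda>k. measure (P (r k) y) (\<Union>S))" if yS: "(y, S) \<in> I" for y S
  proof -
    obtain n where n: "p n = (y, S)" using from_nat_into_surj[OF I(1) yS] by (auto simp: p_def)
    \<comment> \<open>The diagonal sequence refines the sequence selected for index \<open>n\<close>
      only after its first terms are dropped, hence the shift by \<open>Suc n\<close>.\<close>
    have "convergent (\<lambda>k. measure (P ((diagseq \<circ> ((+) (Suc n))) k) (fst (p n))) (\<Union>(snd (p n))))"
    proof (rule diagseq_holds)
      fix t s :: "nat \<Rightarrow> nat" and m assume "strict_mono t"
        and "convergent (\<lambda>k. measure (P (s k) (fst (p m))) (\<Union>(snd (p m))))"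
      from convergent_subseq_convergent[OF this(2,1)]
      show "convergent (\<lambda>k. measure (P ((s \<circ> t) k) (fst (p m))) (\<Union>(snd (p m))))"
        by (simp add: o_def)
    qed
    then have "convergent (\<lambda>k. measure (P (r (k + Suc n)) y) (\<Union>S))"
      by (simp add: n r_def o_def add.commute)
    then show ?thesis
      using convergent_ignore_initial_segment[of "\<lambda>k. measure (P (r k) y) (\<Union>S)" "Suc n"] by simp
  qed
  have conv: "convergent (\<lambda>k. measure (P (r k) y) A)" if A: "A \<in> sets borel" for y A
  proof (rule convergent_if_uniformly_approximated)
    fix e :: real assume e: "0 < e"
    obtain b where b: "\<And>k y' A. norm y' \<le> norm y + 1 \<Longrightarrow> A \<in> sets borel \<Longrightarrow> measure (P k y') A \<le> b * measure \<mu> A"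
      using dom[of "norm y + 1"] by blast
    obtain c where c: "\<And>k z z' A. norm z \<le> norm y + 1 \<Longrightarrow> norm z' \<le> norm y + 1 \<Longrightarrow> A \<in> sets borel \<Longrightarrow>
      \<bar>measure (P k z) A - measure (P k z') A\<bar> \<le> c * dist z z' * measure \<mu> A"
      using lip[of "norm y + 1"] by blast
    \<comment> \<open>Half of \<open>e\<close> pays for replacing \<open>y\<close> by a dense point
      \<open>y'\<close>, half for replacing \<open>A\<close> by a finite union. The cap at 1 keeps
      \<open>y'\<close> in the ball of radius \<open>norm y + 1\<close>, where \<open>b\<close> and
      \<open>c\<close> are valid.\<close>
    define \<delta> where "\<delta> = min 1 (e / (2 * (1 + \<bar>c\<bar>)))"
    have \<delta>: "0 < \<delta>" "\<delta> \<le> 1" "\<bar>c\<bar> * \<delta> \<le> e / 2"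
    proof -
      show "0 < \<delta>" "\<delta> \<le> 1" using e by (auto simp: \<delta>_def)
      have "\<bar>c\<bar> * \<delta> \<le> (1 + \<bar>c\<bar>) * (e / (2 * (1 + \<bar>c\<bar>)))" using e
        by (intro mult_mono) (auto simp: \<delta>_def)
      also have "\<dots> = e / 2" by (simp add: field_simps)
      finally show "\<bar>c\<bar> * \<delta> \<le> e / 2" .
    qed
    obtain y' where y': "y' \<in> D" "dist y y' < \<delta>"
      using D(2)[of "ball y \<delta>"] \<delta>(1) by auto
    have ny: "norm y \<le> norm y + 1" "norm y' \<le> norm y + 1"
      using y'(2) \<delta>(2) norm_triangle_ineq2[of y' y] by (auto simp: dist_norm norm_minus_commute)
    obtain S where S: "finite S" "S \<subseteq> B" "measure \<mu> ((A - \<Union>S) \<union> (\<Union>S - A)) \<le> e / (2 * (1 + \<bar>b\<bar>))"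
      using borel_approx_finite_union[OF finite_measure_axioms \<mu>(2) B A, of "e / (2 * (1 + \<bar>b\<bar>))"] e by auto
    have Sm [measurable]: "\<Union>S \<in> sets borel"
      using S(2) topological_basis_open[OF B(1)] by (intro borel_open open_Union) auto
    let ?d = "(A - \<Union>S) \<union> (\<Union>S - A)"
    have "dist (measure (P (r k) y) A) (measure (P (r k) y') (\<Union>S)) \<le> e" for k
    proof -
      have "\<bar>measure (P (r k) y) A - measure (P (r k) y') A\<bar> \<le> c * dist y y' * measure \<mu> A"
        by (rule c[OF ny A])
      also have "\<dots> \<le> \<bar>c\<bar> * \<delta> * 1"
        using y'(2) \<delta>(1) by (intro mult_mono) auto
      also have "\<dots> \<le> e / 2" using \<delta> by simp
      finally have 1: "\<bar>measure (P (r k) y) A - measure (P (r k) y') A\<bar> \<le> e / 2" .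
      have "measure (P (r k) y') A \<le> measure (P (r k) y') (\<Union>S \<union> ?d)"
        using A by (intro P.finite_measure_mono) (auto simp: P(2))
      also have "\<dots> \<le> measure (P (r k) y') (\<Union>S) + measure (P (r k) y') ?d"
        using A by (intro measure_Un_le) (auto simp: P(2))
      finally have 2: "measure (P (r k) y') A \<le> measure (P (r k) y') (\<Union>S) + measure (P (r k) y') ?d" .
      have "measure (P (r k) y') (\<Union>S) \<le> measure (P (r k) y') (A \<union> ?d)"
        using A by (intro P.finite_measure_mono) (auto simp: P(2))
      also have "\<dots> \<le> measure (P (r k) y') A + measure (P (r k) y') ?d"
        using A by (intro measure_Un_le) (auto simp: P(2))
      finally have 3: "measure (P (r k) y') (\<Union>S) \<le> measure (P (r k) y') A + measure (P (r k) y') ?d" .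
      have "measure (P (r k) y') ?d \<le> b * measure \<mu> ?d"
        using A by (intro b[OF ny(2)]) auto
      also have "\<dots> \<le> (1 + \<bar>b\<bar>) * (e / (2 * (1 + \<bar>b\<bar>)))"
        using S(3) by (intro mult_mono) auto
      also have "\<dots> = e / 2" by (simp add: field_simps)
      finally show ?thesis using 1 2 3 unfolding dist_real_def by linarith
    qed
    moreover have "convergent (\<lambda>k. measure (P (r k) y') (\<Union>S))"
      using y'(1) S by (intro conv_I) (auto simp: I_def)
    ultimately show "\<exists>g. convergent g \<and> (\<forall>k. dist (measure (P (r k) y) A) (g k) \<le> e)" by blast
  qed
  have "\<exists>Q. prob_space Q \<and> sets Q = sets borel \<and>
      (\<forall>A\<in>sets borel. (\<lambda>k. measure (P (r k) y) A) \<longlonglongrightarrow> measure Q A)" for y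
  proof -
    obtain b where "\<And>k A. A \<in> sets borel \<Longrightarrow> measure (P k y) A \<le> b * measure \<mu> A"
      using dom[of "norm y"] by blast
    then show ?thesis
      by (intro setwise_limit_is_measure[OF finite_measure_axioms \<mu>(2) P] conv)
  qed
  then have "\<forall>y. \<exists>Q. prob_space Q \<and> sets Q = sets borel \<and>
      (\<forall>A\<in>sets borel. (\<lambda>k. measure (P (r k) y) A) \<longlonglongrightarrow> measure Q A)" ..
  from choice[OF this] r show ?thesis by blast
qed

subsection \<open>Uniform estimates for posteriors\<close>

context
  fixes \<Gamma> :: "real^'n^'n"
  assumes \<Gamma>: "sym_pos_def \<Gamma>"
begin

text \<open>Positive definiteness makes the kernel of \<open>\<Gamma>\<close> trivial, so
  \<open>y\<close> is the image of some \<open>z\<close>, and the form at \<open>y\<close> is the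
  form of \<open>\<Gamma>\<close> at \<open>z\<close>.\<close>

lemma matrix_inv_quadratic_pos:
  assumes y: "y \<noteq> 0"
  shows "0 < y \<bullet> (matrix_inv \<Gamma> *v y)"
proof -
  have "\<Gamma> *v x = 0 \<longrightarrow> x = 0" for x
    using \<Gamma> unfolding sym_pos_def_def by (metis inner_zero_right less_irrefl)
  then have "invertible \<Gamma>"
    by (simp add: invertible_left_inverse matrix_left_invertible_ker)
  then have "\<Gamma> ** matrix_inv \<Gamma> = mat 1"
    unfolding matrix_inv_def invertible_def by (rule someI2_ex) auto
  then have z: "\<Gamma> *v (matrix_inv \<Gamma> *v y) = y"
    by (simp add: matrix_vector_mul_assoc)
  then have "matrix_inv \<Gamma> *v y \<noteq> 0" using y by auto
  then have "0 < (matrix_inv \<Gamma> *v y) \<bullet> (\<Gamma> *v (matrix_inv \<Gamma> *v y))"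
    using \<Gamma> by (simp add: sym_pos_def_def)
  then show ?thesis by (simp add: z inner_commute)
qed

lemma matrix_inv_quadratic_nonneg: "0 \<le> y \<bullet> (matrix_inv \<Gamma> *v y)"
  using matrix_inv_quadratic_pos[of y] by (cases "y = 0") auto

lemma gnorm_nonneg: "0 \<le> gnorm \<Gamma> y"
  by (simp add: gnorm_def matrix_inv_quadratic_nonneg)

lemma gnorm_power2: "(gnorm \<Gamma> y)\<^sup>2 = y \<bullet> (matrix_inv \<Gamma> *v y)"
  by (simp add: gnorm_def matrix_inv_quadratic_nonneg)

text \<open>The parallelogram law with the square of the sum dropped.\<close>

lemma gnorm_diff_power2_le: "(gnorm \<Gamma> (x - y))\<^sup>2 \<le> 2 * (gnorm \<Gamma> x)\<^sup>2 + 2 * (gnorm \<Gamma> y)\<^sup>2"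
proof -
  have "(gnorm \<Gamma> (x - y))\<^sup>2 + (gnorm \<Gamma> (x + y))\<^sup>2 = 2 * (gnorm \<Gamma> x)\<^sup>2 + 2 * (gnorm \<Gamma> y)\<^sup>2"
    unfolding gnorm_power2 by (simp add: matrix_vector_mult_diff_distrib matrix_vector_right_distrib algebra_simps)
  then show ?thesis using zero_le_power2[of "gnorm \<Gamma> (x + y)"] by linarith
qed

lemma continuous_on_gnorm: "continuous_on S (gnorm \<Gamma>)"
  unfolding gnorm_def[abs_def] by (intro continuous_intros)

lemma gnorm_scaleR: "gnorm \<Gamma> (c *\<^sub>R y) = \<bar>c\<bar> * gnorm \<Gamma> y"
  by (simp add: gnorm_def matrix_vector_mult_scaleR real_sqrt_mult mult.assoc[symmetric])

text \<open>By homogeneity the compact unit sphere decides: there the continuous function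
  \<open>gnorm \<Gamma>\<close> attains a positive minimum and a maximum.\<close>

lemma gnorm_equiv_norm:
  obtains a b where "0 < a" "0 < b" "\<And>y. a * norm y \<le> gnorm \<Gamma> y" "\<And>y. gnorm \<Gamma> y \<le> b * norm y"
proof -
  let ?S = "sphere (0 :: real^'n) 1"
  have ne: "?S \<noteq> {}" by simp
  have cpt: "compact ?S" by simp
  obtain m where m: "m \<in> ?S" "\<And>y. y \<in> ?S \<Longrightarrow> gnorm \<Gamma> m \<le> gnorm \<Gamma> y"
    using continuous_attains_inf[OF cpt ne continuous_on_gnorm] by auto
  obtain M where M: "M \<in> ?S" "\<And>y. y \<in> ?S \<Longrightarrow> gnorm \<Gamma> y \<le> gnorm \<Gamma> M"
    using continuous_attains_sup[OF cpt ne continuous_on_gnorm] by auto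
  have m0: "0 < gnorm \<Gamma> m"
    using m(1) matrix_inv_quadratic_pos[of m] by (force simp: gnorm_def)
  have scale: "gnorm \<Gamma> y = norm y * gnorm \<Gamma> ((1 / norm y) *\<^sub>R y)" if "y \<noteq> 0" for y
    using that unfolding gnorm_scaleR by simp
  show thesis
  proof (rule that[OF m0, of "gnorm \<Gamma> M"])
    show "0 < gnorm \<Gamma> M" using m0 M(2)[OF m(1)] by simp
    fix y
    show "gnorm \<Gamma> m * norm y \<le> gnorm \<Gamma> y"
    proof (cases "y = 0")
      case False
      then have "gnorm \<Gamma> m \<le> gnorm \<Gamma> ((1 / norm y) *\<^sub>R y)" by (intro m(2)) simp
      then show ?thesis using scale[OF False] by (simp add: mult.commute mult_left_mono)
    qed (simp add: gnorm_nonneg)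
    show "gnorm \<Gamma> y \<le> gnorm \<Gamma> M * norm y"
    proof (cases "y = 0")
      case False
      then have "gnorm \<Gamma> ((1 / norm y) *\<^sub>R y) \<le> gnorm \<Gamma> M" by (intro M(2)) simp
      then show ?thesis using scale[OF False] by (simp add: mult.commute mult_left_mono)
    qed (simp add: gnorm_def)
  qed
qed

lemma compact_gnorm_ball: "compact {y. gnorm \<Gamma> y \<le> R}"
proof -
  obtain a b where a: "0 < a" "\<And>y. a * norm y \<le> gnorm \<Gamma> y"
    using gnorm_equiv_norm by metis
  have "norm y \<le> R / a" if "gnorm \<Gamma> y \<le> R" for y
    using a(2)[of y] that a(1) by (simp add: field_simps)
  then have "bounded {y. gnorm \<Gamma> y \<le> R}" by (auto simp: bounded_iff)
  moreover have "closed {y. gnorm \<Gamma> y \<le> R}"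
    by (intro closed_Collect_le continuous_on_gnorm continuous_on_const)
  ultimately show ?thesis by (simp add: compact_eq_bounded_closed)
qed

end

section \<open>Posterior masses as quotients of real integrals\<close>

lemma measure_posterior:
  fixes \<mu> :: "'x::topological_space measure" and \<rho> :: "real^'n \<Rightarrow> real"
  assumes "prob_space \<mu>" and s\<mu> [measurable_cong]: "sets \<mu> = sets borel"
    and \<rho> [measurable]: "\<rho> \<in> borel_measurable borel" and \<rho>b: "\<And>y. 0 \<le> \<rho> y" "\<And>y. \<rho> y \<le> b"
    and L [measurable]: "L \<in> borel_measurable borel" and Z: "0 < Zpost \<mu> \<rho> L y"
  shows "A \<in> sets borel \<Longrightarrow> measure (posterior \<mu> \<rho> L y) A = (LINT u:A|\<mu>. \<rho> (y - L u)) / Zpost \<mu> \<rho> L y"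
    and "prob_space (posterior \<mu> \<rho> L y)"
proof -
  interpret prob_space \<mu> by fact
  have L' [measurable]: "L \<in> borel_measurable \<mu>" by measurable
  have sp: "space \<mu> = UNIV" using sets_eq_imp_space_eq[OF s\<mu>] by simp
  have e: "emeasure (posterior \<mu> \<rho> L y) A = ennreal ((LINT u:A|\<mu>. \<rho> (y - L u)) / Zpost \<mu> \<rho> L y)"
    if A [measurable]: "A \<in> sets borel" for A
  proof -
    have "emeasure (posterior \<mu> \<rho> L y) A = (\<integral>\<^sup>+u. ennreal (\<rho> (y - L u) / Zpost \<mu> \<rho> L y) * indicator A u \<partial>\<mu>)"
      unfolding posterior_def by (rule emeasure_density) (auto simp: s\<mu>)
    also have "\<dots> = (\<integral>\<^sup>+u. ennreal (indicator A u * \<rho> (y - L u) / Zpost \<mu> \<rho> L y) \<partial>\<mu>)"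
      by (intro nn_integral_cong) (auto split: split_indicator)
    also have "\<dots> = ennreal (\<integral>u. indicator A u * \<rho> (y - L u) / Zpost \<mu> \<rho> L y \<partial>\<mu>)"
    proof (rule nn_integral_eq_integral)
      have "norm (indicator A u * \<rho> (y - L u) / Zpost \<mu> \<rho> L y) \<le> b / Zpost \<mu> \<rho> L y" for u
        using \<rho>b[of "y - L u"] Z by (auto split: split_indicator intro!: divide_right_mono)
      then show "integrable \<mu> (\<lambda>u. indicator A u * \<rho> (y - L u) / Zpost \<mu> \<rho> L y)"
        by (intro integrable_const_bound[of _ "b / Zpost \<mu> \<rho> L y"]) auto
    qed (use \<rho>b Z in \<open>auto split: split_indicator\<close>)
    finally show ?thesis by (simp add: set_lebesgue_integral_def)
  qed
  have LINT0: "0 \<le> (LINT u:A|\<mu>. \<rho> (y - L u))" for A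
    using \<rho>b unfolding set_lebesgue_integral_def by (intro integral_nonneg_AE) auto
  show "measure (posterior \<mu> \<rho> L y) A = (LINT u:A|\<mu>. \<rho> (y - L u)) / Zpost \<mu> \<rho> L y" if "A \<in> sets borel"
    using e[OF that] LINT0 Z by (simp add: measure_def)
  show "prob_space (posterior \<mu> \<rho> L y)"
    using e[of UNIV] Z sp by (intro prob_spaceI) (simp add: posterior_def Zpost_def set_lebesgue_integral_def)
qed

text \<open>One member of an admissible family in isolation. Constants valid for all such maps
  cannot depend on the family or on \<open>\<Delta>\<close>.\<close>

definition admissible_map :: "real^'n^'n \<Rightarrow> 'x::topological_space measure \<Rightarrow> real \<Rightarrow> ('x \<Rightarrow> real^'n) \<Rightarrow> bool" where
  "admissible_map \<Gamma> \<mu> M L \<longleftrightarrow> L \<in> borel_measurable borel \<and>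
     (\<integral>\<^sup>+u. ennreal ((gnorm \<Gamma> (L u))\<^sup>2) \<partial>\<mu>) \<le> ennreal (M\<^sup>2)"

text \<open>By Chebyshev's inequality the set \<open>E\<close> where the forward map is large has
  mass at most \<open>d / 2\<close>, so \<open>A - E\<close> has mass at least \<open>d / 2\<close>,
  and there the noise density is at least \<open>a\<close>. With \<open>A = UNIV\<close> this bounds
  the evidence; general \<open>A\<close> is what later keeps the limit density positive.\<close>

lemma evidence_lower_bound:
  fixes \<mu> :: "'x::topological_space measure" and \<rho> :: "real^'n \<Rightarrow> real"
  assumes \<Gamma>: "sym_pos_def \<Gamma>" and \<rho>: "noise_density \<Gamma> \<rho>"
    and \<mu>: "prob_space \<mu>" and s\<mu> [measurable_cong]: "sets \<mu> = sets borel" and d: "0 < d"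
  obtains \<kappa> where "0 < \<kappa>"
    "\<And>L y A. admissible_map \<Gamma> \<mu> M L \<Longrightarrow> gnorm \<Gamma> y \<le> R \<Longrightarrow> A \<in> sets borel \<Longrightarrow> d \<le> measure \<mu> A \<Longrightarrow> \<kappa> \<le> (LINT u:A|\<mu>. \<rho> (y - L u))"
proof -
  interpret prob_space \<mu> by fact
  obtain C b where \<rho>m [measurable]: "\<rho> \<in> borel_measurable borel" and \<rho>pos: "\<And>y. 0 < \<rho> y"
    and b: "\<And>y. \<rho> y \<le> b" and C: "0 < C" "\<And>y. exp (- (gnorm \<Gamma> y)\<^sup>2 / 2) / C \<le> \<rho> y"
    using \<rho> by (auto simp: noise_density_def)
  have sp: "space \<mu> = UNIV" using sets_eq_imp_space_eq[OF s\<mu>] by simp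
  \<comment> \<open>Chosen so that \<open>M\<^sup>2 / K \<le> d / 2\<close>; the summand 1 keeps
    \<open>K\<close> positive for \<open>M = 0\<close>.\<close>
  define K where "K = 2 * M\<^sup>2 / d + 1"
  have K: "0 < K" using d by (auto simp: K_def intro!: add_nonneg_pos)
  have MK: "M\<^sup>2 / K \<le> d / 2" using d K by (simp add: K_def field_simps)
  \<comment> \<open>Outside \<open>E\<close>, half the squared weighted norm of
    \<open>y - L u\<close> is at most \<open>R\<^sup>2 + K\<close>, by the parallelogram
    bound.\<close>
  define a where "a = exp (- (R\<^sup>2 + K)) / C"
  have a: "0 < a" using C(1) by (simp add: a_def)
  have gm [measurable]: "gnorm \<Gamma> \<in> borel_measurable borel"
    using continuous_on_gnorm[OF \<Gamma>] by (rule borel_measurable_continuous_onI)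
  have "a * (d / 2) \<le> (LINT u:A|\<mu>. \<rho> (y - L u))"
    if adm: "admissible_map \<Gamma> \<mu> M L"
      and y: "gnorm \<Gamma> y \<le> R" and A [measurable]: "A \<in> sets borel" and dA: "d \<le> measure \<mu> A" for L y A
  proof -
    have [measurable]: "L \<in> borel_measurable borel"
      and LM: "(\<integral>\<^sup>+u. ennreal ((gnorm \<Gamma> (L u))\<^sup>2) \<partial>\<mu>) \<le> ennreal (M\<^sup>2)"
      using adm by (auto simp: admissible_map_def)
    have L' [measurable]: "L \<in> borel_measurable \<mu>" by measurable
    define E where "E = {u. K \<le> (gnorm \<Gamma> (L u))\<^sup>2}"
    have "{u\<in>space \<mu>. K \<le> (gnorm \<Gamma> (L u))\<^sup>2} \<in> sets \<mu>" by measurable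
    then have Em [measurable]: "E \<in> sets \<mu>" by (simp add: E_def sp)
    have "emeasure \<mu> {u \<in> space \<mu>. 1 \<le> ennreal (1 / K) * ennreal ((gnorm \<Gamma> (L u))\<^sup>2)}
        \<le> ennreal (1 / K) * (\<integral>\<^sup>+u. ennreal ((gnorm \<Gamma> (L u))\<^sup>2) * indicator (space \<mu>) u \<partial>\<mu>)"
      by (rule nn_integral_Markov_inequality) auto
    also have "{u \<in> space \<mu>. 1 \<le> ennreal (1 / K) * ennreal ((gnorm \<Gamma> (L u))\<^sup>2)} = E"
      using K by (auto simp: E_def sp ennreal_mult[symmetric] ennreal_1[symmetric] simp del: ennreal_1)
    also have "ennreal (1 / K) * (\<integral>\<^sup>+u. ennreal ((gnorm \<Gamma> (L u))\<^sup>2) * indicator (space \<mu>) u \<partial>\<mu>)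
        \<le> ennreal (1 / K) * ennreal (M\<^sup>2)"
      using LM by (intro mult_left_mono) (simp_all add: sp)
    also have "\<dots> = ennreal (M\<^sup>2 / K)" using K by (simp add: ennreal_mult[symmetric])
    finally have "measure \<mu> E \<le> M\<^sup>2 / K"
      using K by (simp add: emeasure_eq_measure mult_left_mono)
    then have E: "measure \<mu> E \<le> d / 2" using MK by (rule order_trans)
    have "measure \<mu> A \<le> measure \<mu> ((A - E) \<union> E)"
      by (intro finite_measure_mono) auto
    also have "\<dots> \<le> measure \<mu> (A - E) + measure \<mu> E"
      by (intro measure_Un_le) auto
    finally have AE: "d / 2 \<le> measure \<mu> (A - E)" using E dA by simp
    have low: "a \<le> \<rho> (y - L u)" if "u \<notin> E" for u
    proof -
      have "(gnorm \<Gamma> y)\<^sup>2 \<le> R\<^sup>2" using y gnorm_nonneg[OF \<Gamma>] by (intro power_mono)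
      then have "(gnorm \<Gamma> (y - L u))\<^sup>2 / 2 \<le> R\<^sup>2 + K"
        using gnorm_diff_power2_le[OF \<Gamma>, of y "L u"] that by (simp add: E_def)
      then have "a \<le> exp (- (gnorm \<Gamma> (y - L u))\<^sup>2 / 2) / C"
        using C(1) by (auto simp: a_def intro!: divide_right_mono)
      then show ?thesis using C(2) by (rule order_trans)
    qed
    have "a * (d / 2) \<le> a * measure \<mu> (A - E)" using a AE by simp
    also have "\<dots> = (\<integral>u. a * indicator (A - E) u \<partial>\<mu>)" by (simp add: sp)
    also have "\<dots> \<le> (\<integral>u. indicator A u *\<^sub>R \<rho> (y - L u) \<partial>\<mu>)"
    proof (rule integral_mono)
      show "integrable \<mu> (\<lambda>u. indicator A u *\<^sub>R \<rho> (y - L u))"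
      proof (rule integrable_const_bound[of _ b])
        have "norm (indicator A u *\<^sub>R \<rho> (y - L u)) \<le> b" for u
          using less_imp_le[OF \<rho>pos] b less_imp_le[OF less_le_trans[OF \<rho>pos b]] by (auto split: split_indicator)
        then show "AE u in \<mu>. norm (indicator A u *\<^sub>R \<rho> (y - L u)) \<le> b" by simp
      qed measurable
      show "integrable \<mu> (\<lambda>u. a * indicator (A - E) u)"
        using a by (intro integrable_const_bound[of _ a]) (auto split: split_indicator)
      show "a * indicator (A - E) u \<le> indicator A u *\<^sub>R \<rho> (y - L u)" for u
        using low[of u] less_imp_le[OF \<rho>pos] by (auto split: split_indicator)
    qed
    finally show ?thesis by (simp add: set_lebesgue_integral_def)
  qed
  then show thesis using a d by (intro that[of "a * (d / 2)"]) auto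
qed


text \<open>Here \<open>p\<close>, \<open>p'\<close> stand for unnormalised masses of a set of prior
  mass \<open>m\<close>, and \<open>z\<close>, \<open>z'\<close> for the evidences. As
  \<open>p'\<close> is itself at most \<open>b * m\<close>, the error due to the evidences carries
  the factor \<open>m\<close> too.\<close>

lemma abs_divide_diff_le:
  fixes p p' z z' k :: real
  assumes k: "0 < k" "k \<le> z" "k \<le> z'" and p: "0 \<le> p'" "p' \<le> b * m" "\<bar>p - p'\<bar> \<le> l * m"
    and z: "\<bar>z - z'\<bar> \<le> l" and bl: "0 \<le> l" "0 \<le> m"
  shows "\<bar>p / z - p' / z'\<bar> \<le> (1 / k + b / k\<^sup>2) * l * m"
proof -
  have pos: "0 < z" "0 < z'" using k by auto
  have "p / z - p' / z' = (p - p') / z + p' * (z' - z) / (z * z')"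
    using pos by (simp add: field_simps)
  then have "\<bar>p / z - p' / z'\<bar> \<le> \<bar>p - p'\<bar> / z + p' * \<bar>z' - z\<bar> / (z * z')"
    using pos p(1) abs_triangle_ineq[of "(p - p') / z" "p' * (z' - z) / (z * z')"] by (simp add: abs_mult)
  also have "\<dots> \<le> (l * m) / k + (b * m) * l / (k * k)"
    using k pos p z bl order_trans[OF p(1,2)]
    by (intro add_mono frac_le mult_mono mult_pos_pos) (auto simp: abs_minus_commute)
  also have "\<dots> = (1 / k + b / k\<^sup>2) * l * m"
    using k(1) by (simp add: power2_eq_square algebra_simps)
  finally show ?thesis .
qed

text \<open>The two upper bounds are proportional to the prior mass of the set, the form that the
  cell estimates consume. All bounds on masses pass to setwise limits.\<close>

lemma posterior_bounds:
  fixes \<mu> :: "'x::topological_space measure" and \<rho> :: "real^'n \<Rightarrow> real"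
  assumes \<Gamma>: "sym_pos_def \<Gamma>" and \<rho>: "noise_density \<Gamma> \<rho>"
    and \<mu>: "prob_space \<mu>" and s\<mu> [measurable_cong]: "sets \<mu> = sets borel"
  shows posterior_prob_space: "admissible_map \<Gamma> \<mu> M L \<Longrightarrow> prob_space (posterior \<mu> \<rho> L y)"
    and posterior_dominated: "\<exists>b. \<forall>L y A. admissible_map \<Gamma> \<mu> M L \<longrightarrow> gnorm \<Gamma> y \<le> R \<longrightarrow> A \<in> sets borel \<longrightarrow>
      measure (posterior \<mu> \<rho> L y) A \<le> b * measure \<mu> A"
    and posterior_lipschitz: "\<exists>c>0. \<forall>L y y' A. admissible_map \<Gamma> \<mu> M L \<longrightarrow> gnorm \<Gamma> y \<le> R \<longrightarrow> gnorm \<Gamma> y' \<le> R \<longrightarrow>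
      A \<in> sets borel \<longrightarrow> \<bar>measure (posterior \<mu> \<rho> L y) A - measure (posterior \<mu> \<rho> L y') A\<bar>
        \<le> c * gnorm \<Gamma> (y - y') * measure \<mu> A"
    and posterior_bounded_below: "0 < d \<Longrightarrow> \<exists>\<kappa>>0. \<forall>L y A. admissible_map \<Gamma> \<mu> M L \<longrightarrow> gnorm \<Gamma> y \<le> R \<longrightarrow>
      A \<in> sets borel \<longrightarrow> d \<le> measure \<mu> A \<longrightarrow> \<kappa> \<le> measure (posterior \<mu> \<rho> L y) A"
proof -
  interpret prob_space \<mu> by fact
  have sp: "space \<mu> = UNIV" using sets_eq_imp_space_eq[OF s\<mu>] by simp
  obtain l\<^sub>0 b where \<rho>m [measurable]: "\<rho> \<in> borel_measurable borel" and \<rho>pos: "\<And>y. 0 < \<rho> y"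
    and b: "\<And>y. \<rho> y \<le> b" and l\<^sub>0: "\<And>y y'. \<bar>\<rho> y - \<rho> y'\<bar> \<le> l\<^sub>0 * gnorm \<Gamma> (y - y')"
    using \<rho> by (auto simp: noise_density_def)
  have b0: "0 < b" using less_le_trans[OF \<rho>pos b] .
  \<comment> \<open>The assumed Lipschitz constant carries no sign; the maximum with 1 makes it
    positive, and with it the constant of the posterior estimate.\<close>
  define l where "l = max 1 l\<^sub>0"
  have l: "\<bar>\<rho> y - \<rho> y'\<bar> \<le> l * gnorm \<Gamma> (y - y')" "0 < l" for y y'
    using l\<^sub>0[of y y'] mult_right_mono[OF max.cobounded2[of l\<^sub>0 1] gnorm_nonneg[OF \<Gamma>, of "y - y'"]]
    by (auto simp: l_def)
  let ?adm = "\<lambda>L. admissible_map \<Gamma> \<mu> M L"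
  define J where "J L y A = (LINT u:A|\<mu>. \<rho> (y - L u))" for L :: "'x \<Rightarrow> real^'n" and y A
  have ZJ: "Zpost \<mu> \<rho> L y = J L y UNIV" for L y
    by (simp add: J_def Zpost_def set_lebesgue_integral_def)
  have int: "set_integrable \<mu> A (\<lambda>u. \<rho> (y - L u))" if "?adm L" "A \<in> sets borel" for L y A
  proof -
    have [measurable]: "L \<in> borel_measurable \<mu>" "A \<in> sets \<mu>"
      using that by (auto simp: admissible_map_def s\<mu> measurable_cong_sets[OF s\<mu> refl])
    have "norm (indicator A u *\<^sub>R \<rho> (y - L u)) \<le> b" for u
      using less_imp_le[OF \<rho>pos] b b0 by (auto split: split_indicator)
    then show ?thesis unfolding set_integrable_def
      by (intro integrable_const_bound[of _ b]) auto
  qed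
  have intc: "set_integrable \<mu> A (\<lambda>u. c)" "(LINT u:A|\<mu>. c) = c * measure \<mu> A"
    if "A \<in> sets borel" for A and c :: real
  proof -
    have "integrable \<mu> (indicator A :: 'x \<Rightarrow> real)"
      using that by (intro integrable_real_indicator) (auto simp: s\<mu> less_top[symmetric])
    then show "set_integrable \<mu> A (\<lambda>u. c)" "(LINT u:A|\<mu>. c) = c * measure \<mu> A"
      by (simp_all add: set_integrable_def set_lebesgue_integral_def sp)
  qed
  have Jle: "J L y A \<le> b * measure \<mu> A" and J0: "0 \<le> J L y A" if "?adm L" "A \<in> sets borel" for L y A
  proof -
    have "J L y A \<le> (LINT u:A|\<mu>. b)" unfolding J_def
      by (intro set_integral_mono int that intc b)
    then show "J L y A \<le> b * measure \<mu> A" by (simp add: intc that)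
    show "0 \<le> J L y A" unfolding J_def set_lebesgue_integral_def
      using less_imp_le[OF \<rho>pos] by (intro integral_nonneg_AE) auto
  qed
  have Jlip: "\<bar>J L y A - J L y' A\<bar> \<le> l * gnorm \<Gamma> (y - y') * measure \<mu> A" if "?adm L" "A \<in> sets borel" for L y y' A
  proof -
    have pt: "\<rho> (y - L u) - \<rho> (y' - L u) \<le> l * gnorm \<Gamma> (y - y')"
      "- (l * gnorm \<Gamma> (y - y')) \<le> \<rho> (y - L u) - \<rho> (y' - L u)" for u
      using l(1)[of "y - L u" "y' - L u"] by auto
    have "J L y A - J L y' A = (LINT u:A|\<mu>. \<rho> (y - L u) - \<rho> (y' - L u))"
      unfolding J_def by (simp add: set_integral_diff int that)
    moreover have "(LINT u:A|\<mu>. \<rho> (y - L u) - \<rho> (y' - L u)) \<le> (LINT u:A|\<mu>. l * gnorm \<Gamma> (y - y'))"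
      by (intro set_integral_mono intc set_integral_diff int that pt)
    moreover have "(LINT u:A|\<mu>. - (l * gnorm \<Gamma> (y - y'))) \<le> (LINT u:A|\<mu>. \<rho> (y - L u) - \<rho> (y' - L u))"
      by (intro set_integral_mono intc set_integral_diff int that pt)
    ultimately show ?thesis unfolding intc(2)[OF that(2)] by (simp add: abs_le_iff)
  qed
  \<comment> \<open>The evidence is \<open>J L y UNIV\<close>, so this is the lower bound with
    \<open>d = 1\<close>.\<close>
  have ex_k: "\<exists>k>0. \<forall>L y. ?adm L \<longrightarrow> gnorm \<Gamma> y \<le> R \<longrightarrow> k \<le> J L y UNIV" for R
  proof (rule evidence_lower_bound[OF \<Gamma> \<rho> \<mu> s\<mu>, of 1 M R])
    fix k assume "0 < k" and "\<And>L y A. ?adm L \<Longrightarrow> gnorm \<Gamma> y \<le> R \<Longrightarrow> A \<in> sets borel \<Longrightarrow>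
      1 \<le> measure \<mu> A \<Longrightarrow> k \<le> (LINT u:A|\<mu>. \<rho> (y - L u))"
    then show ?thesis using prob_space by (intro exI[of _ k]) (simp add: J_def sp)
  qed simp
  have post: "measure (posterior \<mu> \<rho> L y) A = J L y A / J L y UNIV" "prob_space (posterior \<mu> \<rho> L y)"
    if L: "?adm L" and A: "A \<in> sets borel" for L y A
  proof -
    obtain k where "0 < k" "k \<le> J L y UNIV" using ex_k[of "gnorm \<Gamma> y"] L by (meson order_refl)
    then show "measure (posterior \<mu> \<rho> L y) A = J L y A / J L y UNIV" "prob_space (posterior \<mu> \<rho> L y)"
      using measure_posterior[OF \<mu> s\<mu> \<rho>m less_imp_le[OF \<rho>pos] b, of L y] L A
      by (auto simp: admissible_map_def J_def[symmetric] ZJ)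
  qed
  show "prob_space (posterior \<mu> \<rho> L y)" if "?adm L" using post(2)[OF that, of "{}"] by simp
  obtain k where k: "0 < k" and kJ: "\<And>L y. ?adm L \<Longrightarrow> gnorm \<Gamma> y \<le> R \<Longrightarrow> k \<le> J L y UNIV"
    using ex_k[of R] by meson
  show "\<exists>b. \<forall>L y A. ?adm L \<longrightarrow> gnorm \<Gamma> y \<le> R \<longrightarrow> A \<in> sets borel \<longrightarrow>
      measure (posterior \<mu> \<rho> L y) A \<le> b * measure \<mu> A"
  proof (intro exI allI impI)
    fix L y and A :: "'x set" assume L: "?adm L" and y: "gnorm \<Gamma> y \<le> R" and A: "A \<in> sets borel"
    have "J L y A / J L y UNIV \<le> (b * measure \<mu> A) / k"
      using Jle[OF L A] order_trans[OF J0[OF L A] Jle[OF L A]] kJ[OF L y] k by (intro frac_le) auto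
    then show "measure (posterior \<mu> \<rho> L y) A \<le> b / k * measure \<mu> A"
      by (simp add: post(1)[OF L A])
  qed
  have "\<bar>measure (posterior \<mu> \<rho> L y) A - measure (posterior \<mu> \<rho> L y') A\<bar>
        \<le> (1 / k + b / k\<^sup>2) * l * gnorm \<Gamma> (y - y') * measure \<mu> A"
    if L: "?adm L" and y: "gnorm \<Gamma> y \<le> R" "gnorm \<Gamma> y' \<le> R" and A: "A \<in> sets borel" for L y y' A
  proof -
    have "\<bar>J L y A / J L y UNIV - J L y' A / J L y' UNIV\<bar> \<le>
        (1 / k + b / k\<^sup>2) * (l * gnorm \<Gamma> (y - y')) * measure \<mu> A"
      using Jlip[OF L, of UNIV y y'] prob_space gnorm_nonneg[OF \<Gamma>, of "y - y'"] l(2)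
      by (intro abs_divide_diff_le k kJ L y J0 Jle Jlip A) (auto simp: sp)
    then show ?thesis
      by (simp add: post(1)[OF L A] mult.assoc)
  qed
  moreover have "0 < (1 / k + b / k\<^sup>2) * l"
    using k b0 l(2) by (intro mult_pos_pos add_pos_pos) auto
  ultimately show "\<exists>c>0. \<forall>L y y' A. ?adm L \<longrightarrow> gnorm \<Gamma> y \<le> R \<longrightarrow> gnorm \<Gamma> y' \<le> R \<longrightarrow>
      A \<in> sets borel \<longrightarrow> \<bar>measure (posterior \<mu> \<rho> L y) A - measure (posterior \<mu> \<rho> L y') A\<bar>
        \<le> c * gnorm \<Gamma> (y - y') * measure \<mu> A"
    by (intro exI[of _ "(1 / k + b / k\<^sup>2) * l"]) simp
  assume d: "0 < d"
  show "\<exists>\<kappa>>0. \<forall>L y A. ?adm L \<longrightarrow> gnorm \<Gamma> y \<le> R \<longrightarrow>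
      A \<in> sets borel \<longrightarrow> d \<le> measure \<mu> A \<longrightarrow> \<kappa> \<le> measure (posterior \<mu> \<rho> L y) A"
  proof (rule evidence_lower_bound[OF \<Gamma> \<rho> \<mu> s\<mu> d, of M R], intro exI conjI allI impI)
    fix \<kappa> assume \<kappa>: "0 < \<kappa>" and *: "\<And>L y A. ?adm L \<Longrightarrow> gnorm \<Gamma> y \<le> R \<Longrightarrow> A \<in> sets borel \<Longrightarrow>
      d \<le> measure \<mu> A \<Longrightarrow> \<kappa> \<le> (LINT u:A|\<mu>. \<rho> (y - L u))"
    \<comment> \<open>The unnormalised mass is at least \<open>\<kappa>\<close> and the evidence at
      most \<open>b\<close>.\<close>
    show "0 < \<kappa> / b" using \<kappa> b0 by simp
    fix L y and A :: "'x set"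
    assume L: "?adm L" "gnorm \<Gamma> y \<le> R" "A \<in> sets borel" "d \<le> measure \<mu> A"
    have "\<kappa> / b \<le> J L y A / J L y UNIV"
      using *[OF L, folded J_def] Jle[OF L(1), of UNIV y] \<kappa> kJ[OF L(1,2)] k prob_space J0[OF L(1,3), of y]
      by (intro frac_le) (auto simp: sp)
    then show "\<kappa> / b \<le> measure (posterior \<mu> \<rho> L y) A" by (simp add: post(1)[OF L(1,3)])
  qed
qed

subsection \<open>Limits of posteriors\<close>

text \<open>Domination on sets is domination of measures, so the first moment of \<open>Q\<close> is
  at most \<open>b\<close> times that of the prior.\<close>

lemma P1_dominated:
  assumes \<mu>: "P1 \<mu>" and Q: "prob_space Q" "sets Q = sets borel"
    and dom: "\<And>A. A \<in> sets borel \<Longrightarrow> measure Q A \<le> b * measure \<mu> A"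
  shows "P1 Q"
proof -
  interpret \<mu>: prob_space \<mu> using \<mu> by (simp add: P1_def)
  interpret Q: prob_space Q by fact
  have s\<mu>: "sets \<mu> = sets borel" using \<mu> by (simp add: P1_def)
  have m: "(\<lambda>u. ennreal (norm u)) \<in> borel_measurable \<mu>"
    by (simp add: measurable_cong_sets[OF s\<mu> refl])
  have "Q \<le> scale_measure (ennreal b) \<mu>"
  proof (rule le_measure[THEN iffD2])
    show "\<forall>A\<in>sets Q. emeasure Q A \<le> emeasure (scale_measure (ennreal b) \<mu>) A"
    proof
      fix A assume "A \<in> sets Q"
      then have A: "A \<in> sets borel" by (simp add: Q)
      have "ennreal (measure Q A) \<le> ennreal b * ennreal (measure \<mu> A)"
        using ennreal_leI[OF dom[OF A]] by (simp add: ennreal_mult'')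
      then show "emeasure Q A \<le> emeasure (scale_measure (ennreal b) \<mu>) A"
        by (simp add: Q.emeasure_eq_measure \<mu>.emeasure_eq_measure)
    qed
  qed (simp add: Q s\<mu>)
  then have "(\<integral>\<^sup>+u. ennreal (norm u) \<partial>Q) \<le> (\<integral>\<^sup>+u. ennreal (norm u) \<partial>scale_measure (ennreal b) \<mu>)"
    by (rule nn_integral_mono_measure[rotated]) (simp add: Q s\<mu>)
  also have "\<dots> = ennreal b * (\<integral>\<^sup>+u. ennreal (norm u) \<partial>\<mu>)"
    by (rule nn_integral_scale_measure[OF m])
  also have "\<dots> < \<infinity>" using \<mu> by (simp add: P1_def ennreal_mult_less_top)
  finally show ?thesis using Q by (simp add: P1_def)
qed

text \<open>Adding 1 to the first moment keeps the resulting Lipschitz constant positive even for a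
  prior concentrated at 0.\<close>

lemma W1_le_scaled_moment:
  fixes \<mu> :: "'x::{real_normed_vector, second_countable_topology} measure"
  assumes \<mu>: "P1 \<mu>"
    and PQ: "prob_space P" "sets P = sets borel" "prob_space Q" "sets Q = sets borel"
    and c: "0 \<le> c" and d: "0 \<le> d"
    and diff: "\<And>A. A \<in> sets borel \<Longrightarrow> \<bar>measure P A - measure Q A\<bar> \<le> c * d * measure \<mu> A"
  shows "W1 P Q \<le> ennreal (c * (enn2real (\<integral>\<^sup>+u. ennreal (norm u) \<partial>\<mu>) + 1) * d)"
proof -
  define N where "N = enn2real (\<integral>\<^sup>+u. ennreal (norm u) \<partial>\<mu>)"
  have N: "0 \<le> N" "(\<integral>\<^sup>+u. ennreal (norm u) \<partial>\<mu>) = ennreal N"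
    using \<mu> by (auto simp: N_def P1_def)
  have "W1 P Q \<le> ennreal (c * d) * ennreal N"
    unfolding N(2)[symmetric] using c d by (intro W1_le_of_measure_diff_le[OF \<mu> PQ] diff) auto
  also have "\<dots> = ennreal (c * d * N)" using c d N(1) by (simp add: ennreal_mult)
  also have "\<dots> \<le> ennreal (c * (N + 1) * d)"
    using c d by (intro ennreal_leI) (simp add: algebra_simps)
  finally show ?thesis by (simp add: N_def)
qed

text \<open>The Radon-Nikodym density \<open>h\<close> is finite almost everywhere because its
  integral is 1. Its zero set is null for \<open>Q\<close>, hence for \<open>\<mu>\<close>, so
  \<open>- ln h\<close> is real almost everywhere.\<close>

lemma ex_positive_density:
  assumes \<mu>: "prob_space \<mu>" and Q: "prob_space Q" "sets Q = sets \<mu>"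
    and null: "\<And>A. A \<in> sets \<mu> \<Longrightarrow> measure Q A = 0 \<longleftrightarrow> measure \<mu> A = 0"
  obtains \<Phi> :: "'x \<Rightarrow> real" where "\<Phi> \<in> borel_measurable \<mu>" "integrable \<mu> (\<lambda>u. exp (- \<Phi> u))"
    "(\<integral>u. exp (- \<Phi> u) \<partial>\<mu>) = 1" "Q = density \<mu> (\<lambda>u. ennreal (exp (- \<Phi> u)))"
proof -
  interpret \<mu>: prob_space \<mu> by fact
  interpret Q: prob_space Q by fact
  have "absolutely_continuous \<mu> Q"
    using null by (auto simp: absolutely_continuous_def null_sets_def Q \<mu>.emeasure_eq_measure Q.emeasure_eq_measure)
  then obtain h where h [measurable]: "h \<in> borel_measurable \<mu>" and hQ: "density \<mu> h = Q"
    using \<mu>.Radon_Nikodym Q(2) by blast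
  have "emeasure Q {u\<in>space \<mu>. h u = 0} = (\<integral>\<^sup>+u. h u * indicator {u\<in>space \<mu>. h u = 0} u \<partial>\<mu>)"
    unfolding hQ[symmetric] by (rule emeasure_density) auto
  also have "\<dots> = (\<integral>\<^sup>+u. 0 \<partial>\<mu>)"
    by (intro nn_integral_cong) (auto split: split_indicator)
  finally have "measure Q {u\<in>space \<mu>. h u = 0} = 0" by (simp add: measure_def)
  then have "measure \<mu> {u\<in>space \<mu>. h u = 0} = 0" by (subst null[symmetric]) auto
  then have pos: "AE u in \<mu>. h u \<noteq> 0"
    by (intro AE_I[where N = "{u\<in>space \<mu>. h u = 0}"]) (auto simp: \<mu>.emeasure_eq_measure)
  have int1: "(\<integral>\<^sup>+u. h u \<partial>\<mu>) = 1"
  proof -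
    have "(\<integral>\<^sup>+u. h u \<partial>\<mu>) = (\<integral>\<^sup>+u. h u * indicator (space \<mu>) u \<partial>\<mu>)"
      by (intro nn_integral_cong) simp
    also have "\<dots> = emeasure Q (space Q)"
      unfolding hQ[symmetric] by (subst emeasure_density) auto
    finally show ?thesis by (simp add: Q.emeasure_space_1)
  qed
  then have fin: "AE u in \<mu>. h u \<noteq> \<infinity>"
    by (intro nn_integral_noteq_infinite) auto
  \<comment> \<open>Where \<open>h\<close> is 0 or infinite, \<open>enn2real\<close> gives 0 and the
    logarithm takes a default value. So \<open>\<Phi>\<close> is real and measurable everywhere, and
    the density changes only on a null set.\<close>
  define \<Phi> where "\<Phi> u = - ln (enn2real (h u))" for u
  have \<Phi>m [measurable]: "\<Phi> \<in> borel_measurable \<mu>" unfolding \<Phi>_def by measurable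
  have eq: "AE u in \<mu>. h u = ennreal (exp (- \<Phi> u))"
    using pos fin
  proof eventually_elim
    case (elim u)
    then have "0 < enn2real (h u)"
      by (simp add: enn2real_positive_iff less_top zero_less_iff_neq_zero)
    then show ?case using elim by (simp add: \<Phi>_def less_top)
  qed
  have nn1: "(\<integral>\<^sup>+u. ennreal (exp (- \<Phi> u)) \<partial>\<mu>) = 1"
    using nn_integral_cong_AE[OF eq] int1 by simp
  have int: "integrable \<mu> (\<lambda>u. exp (- \<Phi> u))"
    by (rule integrableI_nonneg) (auto simp: nn1)
  show thesis
  proof (rule that[OF \<Phi>m int])
    show "(\<integral>u. exp (- \<Phi> u) \<partial>\<mu>) = 1"
      using nn_integral_eq_integral[OF int] nn1 by (simp add: ennreal_1[symmetric] del: ennreal_1)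
    show "Q = density \<mu> (\<lambda>u. ennreal (exp (- \<Phi> u)))"
      unfolding hQ[symmetric] by (rule density_cong) (use eq in auto)
  qed
qed

text \<open>One subsequence and one \<open>Q\<close> serve all radii. The potentials are chosen
  separately for each \<open>y\<close>, with the normalisation absorbed into them.\<close>

lemma posterior_limit_exists:
  fixes \<mu> :: "'x::{banach, second_countable_topology} measure"
    and \<Gamma> :: "real^'n^'n" and \<rho> :: "real^'n \<Rightarrow> real" and L :: "nat \<Rightarrow> 'x \<Rightarrow> real^'n"
  assumes \<Gamma>: "sym_pos_def \<Gamma>" and \<rho>: "noise_density \<Gamma> \<rho>" and \<mu>: "P1 \<mu>"
    and L: "\<And>k. admissible_map \<Gamma> \<mu> M (L k)"
  obtains r :: "nat \<Rightarrow> nat" and Q :: "real^'n \<Rightarrow> 'x measure" and \<Phi> :: "real^'n \<Rightarrow> 'x \<Rightarrow> real"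
  where "strict_mono r" "\<And>y. P1 (Q y)"
    "\<And>R. (\<lambda>k. SUP y\<in>{y. gnorm \<Gamma> y \<le> R}. W1 (posterior \<mu> \<rho> (L (r k)) y) (Q y)) \<longlonglongrightarrow> 0"
    "\<And>R. \<exists>C>0. \<forall>y y'. gnorm \<Gamma> y \<le> R \<longrightarrow> gnorm \<Gamma> y' \<le> R \<longrightarrow>
      W1 (Q y) (Q y') \<le> ennreal (C * gnorm \<Gamma> (y - y'))"
    "\<And>y. \<Phi> y \<in> borel_measurable borel" "\<And>y. integrable \<mu> (\<lambda>u. exp (- \<Phi> y u))"
    "\<And>y. (\<integral>u. exp (- \<Phi> y u) \<partial>\<mu>) = 1" "\<And>y. Q y = density \<mu> (\<lambda>u. ennreal (exp (- \<Phi> y u)))"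
proof -
  have \<mu>': "prob_space \<mu>" "sets \<mu> = sets borel" using \<mu> by (auto simp: P1_def)
  interpret prob_space \<mu> by fact
  note post = \<Gamma> \<rho> \<mu>'
  \<comment> \<open>The estimates use balls in \<open>gnorm\<close>, the diagonal argument balls in
    the Euclidean norm; \<open>g\<close> converts radii and Lipschitz constants.\<close>
  obtain g where g: "0 < g" "\<And>y. gnorm \<Gamma> y \<le> g * norm y"
    using gnorm_equiv_norm[OF \<Gamma>] by metis
  let ?P = "\<lambda>k y. posterior \<mu> \<rho> (L k) y"
  have sP: "sets (?P k y) = sets borel" for k y by (simp add: posterior_def \<mu>')
  have pP: "prob_space (?P k y)" for k y
    by (rule posterior_prob_space[OF post L])
  have domg: "\<exists>b. \<forall>k y A. gnorm \<Gamma> y \<le> R \<longrightarrow> A \<in> sets borel \<longrightarrow> measure (?P k y) A \<le> b * measure \<mu> A" for R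
    using posterior_dominated[OF post, of M R] L by meson
  have lipg: "\<exists>c>0. \<forall>k y y' A. gnorm \<Gamma> y \<le> R \<longrightarrow> gnorm \<Gamma> y' \<le> R \<longrightarrow> A \<in> sets borel \<longrightarrow>
      \<bar>measure (?P k y) A - measure (?P k y') A\<bar> \<le> c * gnorm \<Gamma> (y - y') * measure \<mu> A" for R
    using posterior_lipschitz[OF post, of M R] L by meson
  have gR: "gnorm \<Gamma> y \<le> g * R" if "norm y \<le> R" for y R
    using g(2)[of y] that g(1) by (meson mult_left_mono less_imp_le order_trans)
  have c_dist: "c * gnorm \<Gamma> (y - y') * measure \<mu> A \<le> c * g * dist y y' * measure \<mu> A" if "0 < c" for c y y' A
    using g(2)[of "y - y'"] that by (intro mult_right_mono) (auto simp: dist_norm mult.assoc)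
  have dom: "\<exists>b. \<forall>k y A. norm y \<le> R \<longrightarrow> A \<in> sets borel \<longrightarrow> measure (?P k y) A \<le> b * measure \<mu> A" for R
    using domg[of "g * R"] gR by blast
  have lip: "\<exists>c. \<forall>k y y' A. norm y \<le> R \<longrightarrow> norm y' \<le> R \<longrightarrow> A \<in> sets borel \<longrightarrow>
      \<bar>measure (?P k y) A - measure (?P k y') A\<bar> \<le> c * dist y y' * measure \<mu> A" for R
  proof -
    obtain c where c: "0 < c" "\<And>k y y' A. gnorm \<Gamma> y \<le> g * R \<Longrightarrow> gnorm \<Gamma> y' \<le> g * R \<Longrightarrow> A \<in> sets borel \<Longrightarrow>
      \<bar>measure (?P k y) A - measure (?P k y') A\<bar> \<le> c * gnorm \<Gamma> (y - y') * measure \<mu> A"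
      using lipg[of "g * R"] by blast
    have "\<bar>measure (?P k y) A - measure (?P k y') A\<bar> \<le> (c * g) * dist y y' * measure \<mu> A"
      if "norm y \<le> R" "norm y' \<le> R" "A \<in> sets borel" for k y y' A
      by (rule order_trans[OF c(2) c_dist[OF c(1)]]) (use that gR in auto)
    then show ?thesis by blast
  qed
  obtain r Q where r: "strict_mono (r :: nat \<Rightarrow> nat)" and pQ: "\<And>y. prob_space (Q y)"
    and sQ: "\<And>y. sets (Q y) = sets borel"
    and conv: "\<And>y A. A \<in> sets borel \<Longrightarrow> (\<lambda>k. measure (?P (r k) y) A) \<longlonglongrightarrow> measure (Q y) A"
    using setwise_subsequence_exists[of \<mu> ?P, OF \<mu>' pP sP dom lip] by blast
  have domQ: "\<exists>b. \<forall>A\<in>sets borel. measure (Q y) A \<le> b * measure \<mu> A" for y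
  proof -
    obtain b where b: "\<And>k A. A \<in> sets borel \<Longrightarrow> measure (?P k y) A \<le> b * measure \<mu> A"
      using domg[of "gnorm \<Gamma> y"] by auto
    have "measure (Q y) A \<le> b * measure \<mu> A" if "A \<in> sets borel" for A
      using conv[OF that] by (rule LIMSEQ_le_const2) (use b[OF that] in blast)
    then show ?thesis by blast
  qed
  \<comment> \<open>The lower bound \<open>\<kappa>\<close> is uniform in \<open>k\<close>, so it
    survives the setwise limit. This excludes zeros of the limit density on a set of positive prior
    mass.\<close>
  have lowQ: "0 < measure (Q y) A" if A: "A \<in> sets borel" "0 < measure \<mu> A" for y A
  proof -
    obtain \<kappa> where \<kappa>: "0 < \<kappa>" "\<And>k. \<kappa> \<le> measure (?P k y) A"
      using posterior_bounded_below[OF post A(2), of M "gnorm \<Gamma> y"] L A(1) by (meson order_refl)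
    have "\<kappa> \<le> measure (Q y) A"
      using conv[OF A(1)] by (rule LIMSEQ_le_const) (use \<kappa> in blast)
    then show ?thesis using \<kappa>(1) by simp
  qed
  have "\<forall>y. \<exists>\<Phi>. \<Phi> \<in> borel_measurable borel \<and> integrable \<mu> (\<lambda>u. exp (- \<Phi> u)) \<and>
    (\<integral>u. exp (- \<Phi> u) \<partial>\<mu>) = 1 \<and> Q y = density \<mu> (\<lambda>u. ennreal (exp (- \<Phi> u)))"
  proof
    fix y
    have null: "measure (Q y) A = 0 \<longleftrightarrow> measure \<mu> A = 0" if "A \<in> sets \<mu>" for A
    proof
      show "measure \<mu> A = 0" if "measure (Q y) A = 0"
        using lowQ[of A y] \<open>A \<in> sets \<mu>\<close> that \<mu>'(2) by (auto simp: zero_less_measure_iff)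
      show "measure (Q y) A = 0" if "measure \<mu> A = 0"
      proof -
        obtain b where "measure (Q y) A \<le> b * measure \<mu> A"
          using domQ[of y] \<open>A \<in> sets \<mu>\<close> \<mu>'(2) by blast
        with that show ?thesis using measure_nonneg[of "Q y" A] by simp
      qed
    qed
    have "sets (Q y) = sets \<mu>" using sQ[of y] \<mu>'(2) by simp
    from ex_positive_density[OF \<mu>'(1) pQ this null] obtain \<Phi> :: "'x \<Rightarrow> real" where
      "\<Phi> \<in> borel_measurable \<mu>" "integrable \<mu> (\<lambda>u. exp (- \<Phi> u))"
      "(\<integral>u. exp (- \<Phi> u) \<partial>\<mu>) = 1" "Q y = density \<mu> (\<lambda>u. ennreal (exp (- \<Phi> u)))" by blast
    moreover from this(1) have "\<Phi> \<in> borel_measurable borel"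
      by (simp add: measurable_cong_sets[OF \<mu>'(2) refl])
    ultimately
    show "\<exists>\<Phi>. \<Phi> \<in> borel_measurable borel \<and> integrable \<mu> (\<lambda>u. exp (- \<Phi> u)) \<and>
      (\<integral>u. exp (- \<Phi> u) \<partial>\<mu>) = 1 \<and> Q y = density \<mu> (\<lambda>u. ennreal (exp (- \<Phi> u)))"
      by blast
  qed
  from choice[OF this] obtain \<Phi> where \<Phi>: "\<And>y. \<Phi> y \<in> borel_measurable borel"
    "\<And>y. integrable \<mu> (\<lambda>u. exp (- \<Phi> y u))"
    "\<And>y. (\<integral>u. exp (- \<Phi> y u) \<partial>\<mu>) = 1" "\<And>y. Q y = density \<mu> (\<lambda>u. ennreal (exp (- \<Phi> y u)))"
    by blast
  show thesis
  proof (rule that[OF r _ _ _ \<Phi>])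
    show "P1 (Q y)" for y
      using domQ[of y] P1_dominated[OF \<mu> pQ sQ] by blast
    fix R
    obtain b where b: "\<And>k y A. gnorm \<Gamma> y \<le> R \<Longrightarrow> A \<in> sets borel \<Longrightarrow> measure (?P k y) A \<le> b * measure \<mu> A"
      using domg[of R] by blast
    obtain c where c: "0 < c" "\<And>k y y' A. gnorm \<Gamma> y \<le> R \<Longrightarrow> gnorm \<Gamma> y' \<le> R \<Longrightarrow> A \<in> sets borel \<Longrightarrow>
      \<bar>measure (?P k y) A - measure (?P k y') A\<bar> \<le> c * gnorm \<Gamma> (y - y') * measure \<mu> A"
      using lipg[of R] by blast
    show "(\<lambda>k. SUP y\<in>{y. gnorm \<Gamma> y \<le> R}. W1 (?P (r k) y) (Q y)) \<longlonglongrightarrow> 0"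
    proof (rule W1_tendsto_uniformly_on_compact[OF \<mu> pP sP pQ sQ compact_gnorm_ball[OF \<Gamma>]])
      fix k y y' and A :: "'x set" assume "y \<in> {y. gnorm \<Gamma> y \<le> R}" "y' \<in> {y. gnorm \<Gamma> y \<le> R}" "A \<in> sets borel"
      then show "\<bar>measure (?P (r k) y) A - measure (?P (r k) y') A\<bar> \<le> (c * g) * dist y y' * measure \<mu> A"
        using order_trans[OF c(2) c_dist[OF c(1)]] by simp
    qed (use b conv in auto)
    let ?N = "enn2real (\<integral>\<^sup>+u. ennreal (norm u) \<partial>\<mu>)"
    have "W1 (Q y) (Q y') \<le> ennreal (c * (?N + 1) * gnorm \<Gamma> (y - y'))"
      if y: "gnorm \<Gamma> y \<le> R" "gnorm \<Gamma> y' \<le> R" for y y'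
    proof (rule W1_le_scaled_moment[OF \<mu> pQ sQ pQ sQ])
      show "\<bar>measure (Q y) A - measure (Q y') A\<bar> \<le> c * gnorm \<Gamma> (y - y') * measure \<mu> A" if A: "A \<in> sets borel" for A
        using tendsto_rabs[OF tendsto_diff[OF conv[OF A, of y] conv[OF A, of y']]]
        by (rule LIMSEQ_le_const2) (use c(2)[OF y A] in blast)
    qed (use c(1) gnorm_nonneg[OF \<Gamma>] in auto)
    then show "\<exists>C>0. \<forall>y y'. gnorm \<Gamma> y \<le> R \<longrightarrow> gnorm \<Gamma> y' \<le> R \<longrightarrow>
      W1 (Q y) (Q y') \<le> ennreal (C * gnorm \<Gamma> (y - y'))"
      using c(1) by (intro exI[of _ "c * (?N + 1)"]) (auto intro!: mult_pos_pos add_nonneg_pos)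
  qed
qed


section \<open>Families of forward maps\<close>

lemma admissible_family_imp_map:
  "admissible_family \<Gamma> \<mu> M L \<Longrightarrow> 0 < \<Delta> \<Longrightarrow> admissible_map \<Gamma> \<mu> M (L \<Delta>)"
  by (simp add: admissible_family_def admissible_map_def)

lemma posterior_W1_lipschitz:
  fixes \<mu> :: "'x::{real_normed_vector, second_countable_topology} measure"
    and \<Gamma> :: "real^'n^'n" and \<rho> :: "real^'n \<Rightarrow> real"
  assumes \<Gamma>: "sym_pos_def \<Gamma>" and \<rho>: "noise_density \<Gamma> \<rho>" and \<mu>: "P1 \<mu>"
  obtains C where "0 < C" "\<And>L y y'. admissible_map \<Gamma> \<mu> M L \<Longrightarrow> gnorm \<Gamma> y \<le> R \<Longrightarrow> gnorm \<Gamma> y' \<le> R \<Longrightarrow>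
    W1 (posterior \<mu> \<rho> L y) (posterior \<mu> \<rho> L y') \<le> ennreal (C * gnorm \<Gamma> (y - y'))"
proof -
  have \<mu>': "prob_space \<mu>" "sets \<mu> = sets borel" using \<mu> by (auto simp: P1_def)
  note post = \<Gamma> \<rho> \<mu>'
  obtain c where c: "0 < c" "\<And>L y y' A. admissible_map \<Gamma> \<mu> M L \<Longrightarrow> gnorm \<Gamma> y \<le> R \<Longrightarrow> gnorm \<Gamma> y' \<le> R \<Longrightarrow>
      A \<in> sets borel \<Longrightarrow> \<bar>measure (posterior \<mu> \<rho> L y) A - measure (posterior \<mu> \<rho> L y') A\<bar>
        \<le> c * gnorm \<Gamma> (y - y') * measure \<mu> A"
    using posterior_lipschitz[OF post, of M R] by meson
  show thesis
  proof (rule that)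
    fix L y y' assume L: "admissible_map \<Gamma> \<mu> M L" and y: "gnorm \<Gamma> y \<le> R" "gnorm \<Gamma> y' \<le> R"
    show "W1 (posterior \<mu> \<rho> L y) (posterior \<mu> \<rho> L y') \<le>
        ennreal (c * (enn2real (\<integral>\<^sup>+u. ennreal (norm u) \<partial>\<mu>) + 1) * gnorm \<Gamma> (y - y'))"
      by (rule W1_le_scaled_moment[OF \<mu> posterior_prob_space[OF post L] _ posterior_prob_space[OF post L]])
         (use c L y \<mu>' gnorm_nonneg[OF \<Gamma>] in \<open>auto simp: posterior_def\<close>)
  qed (use c(1) in \<open>auto intro!: mult_pos_pos add_nonneg_pos\<close>)
qed

theorem mainTheorem4:
  fixes \<mu> :: "'x::{banach, second_countable_topology} measure"
    and \<Gamma> :: "real^'n^'n"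
    and \<rho> :: "real^'n \<Rightarrow> real"
    and L :: "real \<Rightarrow> 'x \<Rightarrow> real^'n"
    and M :: real
  assumes \<Gamma>: "sym_pos_def \<Gamma>"
    and \<rho>: "noise_density \<Gamma> \<rho>"
    and prior: "P1 \<mu>"
    and M: "0 \<le> M"
    and L: "admissible_family \<Gamma> \<mu> M L"
  shows
    \<comment> \<open>uniform local Lipschitz bound, C = C(R,M,rho) independent of the particular family\<close>
    "(\<forall>R>0. \<exists>C>0. \<forall>L'. admissible_family \<Gamma> \<mu> M L' \<longrightarrow>
        (\<forall>\<Delta>>0. \<forall>y y'. gnorm \<Gamma> y \<le> R \<longrightarrow> gnorm \<Gamma> y' \<le> R \<longrightarrow>
           W1 (posterior \<mu> \<rho> (L' \<Delta>) y) (posterior \<mu> \<rho> (L' \<Delta>) y')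
             \<le> ennreal (C * gnorm \<Gamma> (y - y'))))
    \<and>
    \<comment> \<open>pre-compactness in C_loc(R^d; P_1(X)) as Delta \<rightarrow> 0\<close>
    (\<forall>\<Delta>s :: nat \<Rightarrow> real. (\<forall>k. \<Delta>s k > 0) \<and> \<Delta>s \<longlonglongrightarrow> 0 \<longrightarrow>
       (\<exists>r :: nat \<Rightarrow> nat. \<exists>\<mu>s :: real^'n \<Rightarrow> 'x measure. strict_mono r \<and> (\<forall>y. P1 (\<mu>s y)) \<and>
          (\<forall>R>0. (\<lambda>k. SUP y \<in> {y. gnorm \<Gamma> y \<le> R}.
                      W1 (posterior \<mu> \<rho> (L (\<Delta>s (r k))) y) (\<mu>s y)) \<longlonglongrightarrow> 0)))
    \<and>
    \<comment> \<open>properties of any such limit\<close>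
    (\<forall>(\<Delta>s :: nat \<Rightarrow> real) (\<mu>s :: real^'n \<Rightarrow> 'x measure).
       (\<forall>k. \<Delta>s k > 0) \<and> \<Delta>s \<longlonglongrightarrow> 0 \<and> (\<forall>y. P1 (\<mu>s y)) \<and>
       (\<forall>R>0. (\<lambda>k. SUP y \<in> {y. gnorm \<Gamma> y \<le> R}.
                   W1 (posterior \<mu> \<rho> (L (\<Delta>s k)) y) (\<mu>s y)) \<longlonglongrightarrow> 0)
       \<longrightarrow>
       (\<forall>R>0. \<exists>C>0. \<forall>y y'. gnorm \<Gamma> y \<le> R \<longrightarrow> gnorm \<Gamma> y' \<le> R \<longrightarrow>
            W1 (\<mu>s y) (\<mu>s y') \<le> ennreal (C * gnorm \<Gamma> (y - y'))) \<and>
       (\<exists>(\<Phi> :: real^'n \<Rightarrow> 'x \<Rightarrow> real) (Z :: real^'n \<Rightarrow> real). \<forall>y.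
            \<Phi> y \<in> borel_measurable borel \<and>
            integrable \<mu> (\<lambda>u. exp (- \<Phi> y u)) \<and>
            Z y = (\<integral> u. exp (- \<Phi> y u) \<partial>\<mu>) \<and> Z y > 0 \<and>
            \<mu>s y = density \<mu> (\<lambda>u. ennreal (exp (- \<Phi> y u) / Z y))))"
proof -
  have limit: "\<exists>r Q \<Phi>. strict_mono (r :: nat \<Rightarrow> nat) \<and> (\<forall>y. P1 (Q y)) \<and>
      (\<forall>R. (\<lambda>k. SUP y\<in>{y. gnorm \<Gamma> y \<le> R}. W1 (posterior \<mu> \<rho> (L (\<Delta>s (r k))) y) (Q y)) \<longlonglongrightarrow> 0) \<and>
      (\<forall>R. \<exists>C>0. \<forall>y y'. gnorm \<Gamma> y \<le> R \<longrightarrow> gnorm \<Gamma> y' \<le> R \<longrightarrow>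
        W1 (Q y) (Q y') \<le> ennreal (C * gnorm \<Gamma> (y - y'))) \<and>
      (\<forall>y. \<Phi> y \<in> borel_measurable borel \<and> integrable \<mu> (\<lambda>u. exp (- \<Phi> y u)) \<and>
        (\<integral>u. exp (- \<Phi> y u) \<partial>\<mu>) = 1 \<and> Q y = density \<mu> (\<lambda>u. ennreal (exp (- \<Phi> y u))))"
    if "\<forall>k. 0 < \<Delta>s k" for \<Delta>s :: "nat \<Rightarrow> real"
    by (rule posterior_limit_exists[OF \<Gamma> \<rho> prior, of M "\<lambda>k. L (\<Delta>s k)"])
       (use admissible_family_imp_map[OF L] that in blast)+
  show ?thesis
  proof (intro conjI)
    show "\<forall>R>0. \<exists>C>0. \<forall>L'. admissible_family \<Gamma> \<mu> M L' \<longrightarrow>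
        (\<forall>\<Delta>>0. \<forall>y y'. gnorm \<Gamma> y \<le> R \<longrightarrow> gnorm \<Gamma> y' \<le> R \<longrightarrow>
           W1 (posterior \<mu> \<rho> (L' \<Delta>) y) (posterior \<mu> \<rho> (L' \<Delta>) y')
             \<le> ennreal (C * gnorm \<Gamma> (y - y')))"
    proof (intro allI impI)
      fix R :: real
      obtain C where "0 < C" "\<And>L y y'. admissible_map \<Gamma> \<mu> M L \<Longrightarrow> gnorm \<Gamma> y \<le> R \<Longrightarrow> gnorm \<Gamma> y' \<le> R \<Longrightarrow>
          W1 (posterior \<mu> \<rho> L y) (posterior \<mu> \<rho> L y') \<le> ennreal (C * gnorm \<Gamma> (y - y'))"
        using posterior_W1_lipschitz[OF \<Gamma> \<rho> prior, of M R] by auto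
      then show "\<exists>C>0. \<forall>L'. admissible_family \<Gamma> \<mu> M L' \<longrightarrow>
        (\<forall>\<Delta>>0. \<forall>y y'. gnorm \<Gamma> y \<le> R \<longrightarrow> gnorm \<Gamma> y' \<le> R \<longrightarrow>
           W1 (posterior \<mu> \<rho> (L' \<Delta>) y) (posterior \<mu> \<rho> (L' \<Delta>) y')
             \<le> ennreal (C * gnorm \<Gamma> (y - y')))"
        using admissible_family_imp_map by (intro exI[of _ C] conjI allI impI) blast+
    qed
  next
    show "\<forall>\<Delta>s :: nat \<Rightarrow> real. (\<forall>k. \<Delta>s k > 0) \<and> \<Delta>s \<longlonglongrightarrow> 0 \<longrightarrow>
       (\<exists>r :: nat \<Rightarrow> nat. \<exists>\<mu>s :: real^'n \<Rightarrow> 'x measure. strict_mono r \<and> (\<forall>y. P1 (\<mu>s y)) \<and>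
          (\<forall>R>0. (\<lambda>k. SUP y \<in> {y. gnorm \<Gamma> y \<le> R}.
                      W1 (posterior \<mu> \<rho> (L (\<Delta>s (r k))) y) (\<mu>s y)) \<longlonglongrightarrow> 0))"
    proof (intro allI impI)
      fix \<Delta>s :: "nat \<Rightarrow> real" assume "(\<forall>k. \<Delta>s k > 0) \<and> \<Delta>s \<longlonglongrightarrow> 0"
      then obtain r Q where "strict_mono (r :: nat \<Rightarrow> nat)" "\<forall>y. P1 (Q y)"
        "\<forall>R. (\<lambda>k. SUP y\<in>{y. gnorm \<Gamma> y \<le> R}. W1 (posterior \<mu> \<rho> (L (\<Delta>s (r k))) y) (Q y)) \<longlonglongrightarrow> 0"
        using limit[of \<Delta>s] by blast
      then show "\<exists>r :: nat \<Rightarrow> nat. \<exists>\<mu>s :: real^'n \<Rightarrow> 'x measure. strict_mono r \<and> (\<forall>y. P1 (\<mu>s y)) \<and>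
          (\<forall>R>0. (\<lambda>k. SUP y \<in> {y. gnorm \<Gamma> y \<le> R}.
                      W1 (posterior \<mu> \<rho> (L (\<Delta>s (r k))) y) (\<mu>s y)) \<longlonglongrightarrow> 0)"
        by (intro exI[of _ r] exI[of _ Q]) simp
    qed
  next
    show "\<forall>(\<Delta>s :: nat \<Rightarrow> real) (\<mu>s :: real^'n \<Rightarrow> 'x measure).
       (\<forall>k. \<Delta>s k > 0) \<and> \<Delta>s \<longlonglongrightarrow> 0 \<and> (\<forall>y. P1 (\<mu>s y)) \<and>
       (\<forall>R>0. (\<lambda>k. SUP y \<in> {y. gnorm \<Gamma> y \<le> R}.
                   W1 (posterior \<mu> \<rho> (L (\<Delta>s k)) y) (\<mu>s y)) \<longlonglongrightarrow> 0)
       \<longrightarrow>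
       (\<forall>R>0. \<exists>C>0. \<forall>y y'. gnorm \<Gamma> y \<le> R \<longrightarrow> gnorm \<Gamma> y' \<le> R \<longrightarrow>
            W1 (\<mu>s y) (\<mu>s y') \<le> ennreal (C * gnorm \<Gamma> (y - y'))) \<and>
       (\<exists>(\<Phi> :: real^'n \<Rightarrow> 'x \<Rightarrow> real) (Z :: real^'n \<Rightarrow> real). \<forall>y.
            \<Phi> y \<in> borel_measurable borel \<and>
            integrable \<mu> (\<lambda>u. exp (- \<Phi> y u)) \<and>
            Z y = (\<integral> u. exp (- \<Phi> y u) \<partial>\<mu>) \<and> Z y > 0 \<and>
            \<mu>s y = density \<mu> (\<lambda>u. ennreal (exp (- \<Phi> y u) / Z y)))"
    proof (intro allI impI)
      fix \<Delta>s :: "nat \<Rightarrow> real" and \<mu>s :: "real^'n \<Rightarrow> 'x measure"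
      assume A: "(\<forall>k. \<Delta>s k > 0) \<and> \<Delta>s \<longlonglongrightarrow> 0 \<and> (\<forall>y. P1 (\<mu>s y)) \<and>
       (\<forall>R>0. (\<lambda>k. SUP y \<in> {y. gnorm \<Gamma> y \<le> R}. W1 (posterior \<mu> \<rho> (L (\<Delta>s k)) y) (\<mu>s y)) \<longlonglongrightarrow> 0)"
      then obtain r Q \<Phi> where r: "strict_mono (r :: nat \<Rightarrow> nat)" and P1Q: "\<forall>y. P1 (Q y)"
        and lim: "\<forall>R. (\<lambda>k. SUP y\<in>{y. gnorm \<Gamma> y \<le> R}. W1 (posterior \<mu> \<rho> (L (\<Delta>s (r k))) y) (Q y)) \<longlonglongrightarrow> 0"
        and lip: "\<forall>R. \<exists>C>0. \<forall>y y'. gnorm \<Gamma> y \<le> R \<longrightarrow> gnorm \<Gamma> y' \<le> R \<longrightarrow>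
          W1 (Q y) (Q y') \<le> ennreal (C * gnorm \<Gamma> (y - y'))"
        and \<Phi>: "\<forall>y. \<Phi> y \<in> borel_measurable borel \<and> integrable \<mu> (\<lambda>u. exp (- \<Phi> y u)) \<and>
          (\<integral>u. exp (- \<Phi> y u) \<partial>\<mu>) = 1 \<and> Q y = density \<mu> (\<lambda>u. ennreal (exp (- \<Phi> y u)))"
        using limit[of \<Delta>s] by blast
      have "\<mu>s y = Q y" for y
      proof -
        \<comment> \<open>The hypothesis speaks of positive radii only; adding 1 covers
          \<open>y = 0\<close>.\<close>
        define R where "R = gnorm \<Gamma> y + 1"
        have R: "0 < R" "y \<in> {y. gnorm \<Gamma> y \<le> R}" using gnorm_nonneg[OF \<Gamma>, of y] by (simp_all add: R_def)
        have pointwise: "(\<lambda>k. W1 (P k y) (\<nu> y)) \<longlonglongrightarrow> 0"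
          if "(\<lambda>k. SUP y\<in>{y. gnorm \<Gamma> y \<le> R}. W1 (P k y) (\<nu> y)) \<longlonglongrightarrow> 0"
          for P :: "nat \<Rightarrow> real^'n \<Rightarrow> 'x measure" and \<nu>
          using R(2) by (intro tendsto_sandwich[OF _ _ tendsto_const that] always_eventually allI SUP_upper) auto
        have "(\<lambda>k. SUP y\<in>{y. gnorm \<Gamma> y \<le> R}. W1 (posterior \<mu> \<rho> (L (\<Delta>s k)) y) (\<mu>s y)) \<longlonglongrightarrow> 0"
          using A R(1) by blast
        from LIMSEQ_subseq_LIMSEQ[OF pointwise[OF this] r]
        have 1: "(\<lambda>k. W1 (posterior \<mu> \<rho> (L (\<Delta>s (r k))) y) (\<mu>s y)) \<longlonglongrightarrow> 0" by (simp add: o_def)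
        have 2: "(\<lambda>k. W1 (posterior \<mu> \<rho> (L (\<Delta>s (r k))) y) (Q y)) \<longlonglongrightarrow> 0"
          using lim by (intro pointwise) blast
        show ?thesis
          by (rule W1_limit_unique[OF _ _ _ _ _ 1 2]) (use A P1Q prior in \<open>auto simp: P1_def posterior_def\<close>)
      qed
      then have [simp]: "\<mu>s = Q" by blast
      show "(\<forall>R>0. \<exists>C>0. \<forall>y y'. gnorm \<Gamma> y \<le> R \<longrightarrow> gnorm \<Gamma> y' \<le> R \<longrightarrow>
            W1 (\<mu>s y) (\<mu>s y') \<le> ennreal (C * gnorm \<Gamma> (y - y'))) \<and>
       (\<exists>(\<Phi> :: real^'n \<Rightarrow> 'x \<Rightarrow> real) (Z :: real^'n \<Rightarrow> real). \<forall>y.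
            \<Phi> y \<in> borel_measurable borel \<and>
            integrable \<mu> (\<lambda>u. exp (- \<Phi> y u)) \<and>
            Z y = (\<integral> u. exp (- \<Phi> y u) \<partial>\<mu>) \<and> Z y > 0 \<and>
            \<mu>s y = density \<mu> (\<lambda>u. ennreal (exp (- \<Phi> y u) / Z y)))"
        \<comment> \<open>The witness for \<open>Z\<close> is the constant 1, since
          \<open>\<Phi>\<close> already contains the normalisation.\<close>
        using lip \<Phi> by (intro conjI exI[of _ \<Phi>] exI[of _ "\<lambda>_. 1"]) auto
    qed
  qed
qed

end
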